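(* Let $\mathcal{H}_1,\mathcal{H}_2$ be complex Hilbert spaces, let $S\in\mathcal{B}(\mathcal{H}_1)$, $T\in\mathcal{B}(\mathcal{H}_2)$ and let $\lambda\in[0,1]$. Then $M_\lambda(T\otimes S)$ and $M_\lambda(S\otimes T)$ are unitarily equivalent dilations of each other; that is, there is a unitary $V:\mathcal{H}_1\otimes\mathcal{H}_2\to\mathcal{H}_2\otimes\mathcal{H}_1$ such that $$M_\lambda(T\otimes S)=V\,M_\lambda(S\otimes T)\,V^*\quad\text{and}\quad M_\lambda(S\otimes T)=V^*M_\lambda(T\otimes S)V.$$
   Context: $\mathcal{B}(\mathcal{H})$ denotes the bounded linear operators on $\mathcal{H}$. For a bounded operator $T$, $|T|=(T^*T)^{1/2}$ and $T=U|T|$ is the canonical polar decomposition ($U$ a partial isometry with $\ker U=\ker T$). The Duggal transform is $T^D=|T|U$, and the $\lambda$-mean transform is $M_\lambda(T)=\lambda T+(1-\lambda)T^D$. $S\otimes T$ acts on the Hilbert space tensor product $\mathcal{H}_1\otimes\mathcal{H}_2$ by $(S\otimes T)(x\otimes y)=Sx\otimes Ty$, and $T\otimes S$ acts likewise on $\mathcal{H}_2\otimes\mathcal{H}_1$. An operator $B$ on $\mathcal{K}_2$ dilates an operator $A$ on $\mathcal{K}_1$ if $A=W^*BW$ for some isometry $W:\mathcal{K}_1\to\mathcal{K}_2$. *)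

theory Defs
  imports "HOL-Analysis.Analysis"
begin

section \<open>Complex Hilbert spaces\<close>

class complex_vector = real_vector +
  fixes scaleC :: "complex \<Rightarrow> 'a \<Rightarrow> 'a" (infixr "*\<^sub>C" 75)
  assumes scaleC_add_right: "a *\<^sub>C (x + y) = a *\<^sub>C x + a *\<^sub>C y"
    and scaleC_add_left: "(a + b) *\<^sub>C x = a *\<^sub>C x + b *\<^sub>C x"
    and scaleC_scaleC: "a *\<^sub>C (b *\<^sub>C x) = (a * b) *\<^sub>C x"
    and scaleR_scaleC: "r *\<^sub>R x = complex_of_real r *\<^sub>C x"

text \<open>The complex inner product is conjugate-linear in its first argument. Its real part is the
  inner product of the underlying real inner product space, from which norm, metric and
  topology (and positive definiteness) are inherited.\<close>

class complex_inner = complex_vector + real_inner +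
  fixes cinner :: "'a \<Rightarrow> 'a \<Rightarrow> complex" (infix "\<bullet>\<^sub>C" 70)
  assumes cinner_commute: "x \<bullet>\<^sub>C y = cnj (y \<bullet>\<^sub>C x)"
    and cinner_add_right: "x \<bullet>\<^sub>C (y + z) = x \<bullet>\<^sub>C y + x \<bullet>\<^sub>C z"
    and cinner_scaleC_right: "x \<bullet>\<^sub>C (a *\<^sub>C y) = a * (x \<bullet>\<^sub>C y)"
    and inner_eq_Re_cinner: "inner x y = Re (x \<bullet>\<^sub>C y)"

class chilbert_space = complex_inner + complete_space

instantiation complex :: chilbert_space
begin
definition scaleC_complex :: "complex \<Rightarrow> complex \<Rightarrow> complex"
  where "scaleC_complex a x = a * x"
definition cinner_complex :: "complex \<Rightarrow> complex \<Rightarrow> complex"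
  where "cinner_complex x y = cnj x * y"
instance
  by standard
    (auto simp: scaleC_complex_def cinner_complex_def inner_complex_def algebra_simps
      scaleR_conv_of_real)
end

lemma cinner_add_left: "(x + y) \<bullet>\<^sub>C z = x \<bullet>\<^sub>C z + y \<bullet>\<^sub>C z"
  by (metis cinner_add_right cinner_commute complex_cnj_add)

lemma cinner_scaleC_left: "(a *\<^sub>C x) \<bullet>\<^sub>C y = cnj a * (x \<bullet>\<^sub>C y)"
  by (metis cinner_commute cinner_scaleC_right complex_cnj_mult)

lemma scaleC_zero_left [simp]: "0 *\<^sub>C x = 0"
  by (metis of_real_0 scaleR_scaleC scaleR_zero_left)

lemma scaleC_one [simp]: "1 *\<^sub>C x = x"
  by (metis of_real_1 scaleR_scaleC scaleR_one)

lemma scaleC_minus_one: "(- 1) *\<^sub>C x = - x"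
  by (metis of_real_1 of_real_minus scaleR_scaleC scaleR_minus1_left)

lemma cinner_zero_right [simp]: "x \<bullet>\<^sub>C 0 = 0"
  by (metis cinner_scaleC_right mult_zero_left scaleC_zero_left)

lemma cinner_zero_left [simp]: "0 \<bullet>\<^sub>C x = 0"
  by (metis cinner_commute cinner_zero_right complex_cnj_zero)

lemma cinner_minus_right [simp]: "x \<bullet>\<^sub>C (- y) = - (x \<bullet>\<^sub>C y)"
  by (metis cinner_scaleC_right mult_minus1 scaleC_minus_one)

lemma cinner_minus_left [simp]: "(- x) \<bullet>\<^sub>C y = - (x \<bullet>\<^sub>C y)"
  by (metis cinner_commute cinner_minus_right complex_cnj_minus)

lemma cinner_diff_right: "x \<bullet>\<^sub>C (y - z) = x \<bullet>\<^sub>C y - x \<bullet>\<^sub>C z"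
  using cinner_add_right[of x y "- z"] by simp

lemma cinner_diff_left: "(x - y) \<bullet>\<^sub>C z = x \<bullet>\<^sub>C z - y \<bullet>\<^sub>C z"
  using cinner_add_left[of x "- y" z] by simp

lemma cinner_sum_right: "x \<bullet>\<^sub>C (\<Sum>i\<in>F. f i) = (\<Sum>i\<in>F. x \<bullet>\<^sub>C f i)"
  by (induction F rule: infinite_finite_induct) (simp_all add: cinner_add_right)

lemma cinner_sum_left: "(\<Sum>i\<in>F. f i) \<bullet>\<^sub>C x = (\<Sum>i\<in>F. f i \<bullet>\<^sub>C x)"
  by (induction F rule: infinite_finite_induct) (simp_all add: cinner_add_left)

lemma cinner_self: "x \<bullet>\<^sub>C x = complex_of_real ((norm x)\<^sup>2)"
proof -
  have "Im (x \<bullet>\<^sub>C x) = 0"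
    using arg_cong[OF cinner_commute[of x x], of Im] by simp
  moreover have "Re (x \<bullet>\<^sub>C x) = (norm x)\<^sup>2"
    by (simp add: inner_eq_Re_cinner[symmetric] power2_norm_eq_inner)
  ultimately show ?thesis
    by (simp add: complex_eq_iff)
qed

lemma norm_scaleC:
  fixes x :: "'a::complex_inner"
  shows "norm (a *\<^sub>C x) = cmod a * norm x"
proof -
  have "complex_of_real ((norm (a *\<^sub>C x))\<^sup>2) = (a * cnj a) * (x \<bullet>\<^sub>C x)"
    unfolding cinner_self[symmetric] cinner_scaleC_left cinner_scaleC_right by simp
  also have "\<dots> = complex_of_real ((cmod a * norm x)\<^sup>2)"
    by (simp only: cinner_self complex_norm_square[symmetric] power_mult_distrib of_real_mult)
  finally have "(norm (a *\<^sub>C x))\<^sup>2 = (cmod a * norm x)\<^sup>2"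
    using of_real_eq_iff by blast
  then show ?thesis
    by (metis mult_nonneg_nonneg norm_ge_zero power2_eq_imp_eq)
qed

lemma cmod_cinner_le: "cmod (x \<bullet>\<^sub>C y) \<le> norm x * norm y"
proof (cases "x \<bullet>\<^sub>C y = 0")
  case False
  define a where "a = cnj (x \<bullet>\<^sub>C y) / complex_of_real (cmod (x \<bullet>\<^sub>C y))"
  have a: "cmod a = 1"
    using False by (simp add: a_def norm_divide)
  have "x \<bullet>\<^sub>C (a *\<^sub>C y) = complex_of_real (cmod (x \<bullet>\<^sub>C y))"
    using False complex_norm_square[of "x \<bullet>\<^sub>C y"]
    by (simp add: a_def cinner_scaleC_right field_simps power2_eq_square)
  then have "cmod (x \<bullet>\<^sub>C y) = inner x (a *\<^sub>C y)"
    by (simp add: inner_eq_Re_cinner)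
  also have "\<dots> \<le> norm x * norm (a *\<^sub>C y)"
    by (rule norm_cauchy_schwarz)
  finally show ?thesis
    by (simp add: norm_scaleC a)
qed simp

lemma bounded_linear_cinner_right: "bounded_linear (\<lambda>y. x \<bullet>\<^sub>C y)"
proof (rule bounded_linear_intro)
  show "x \<bullet>\<^sub>C (r *\<^sub>R y) = r *\<^sub>R (x \<bullet>\<^sub>C y)" for r y
    by (simp add: scaleR_scaleC[of r y] cinner_scaleC_right scaleR_conv_of_real)
  show "cmod (x \<bullet>\<^sub>C y) \<le> norm y * norm x" for y
    using cmod_cinner_le[of x y] by (simp add: mult.commute)
qed (simp add: cinner_add_right)


section \<open>Bounded operators\<close>

definition bounded_clinear :: "('a::complex_inner \<Rightarrow> 'b::complex_inner) \<Rightarrow> bool" where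
  "bounded_clinear A \<longleftrightarrow> bounded_linear A \<and> (\<forall>c x. A (c *\<^sub>C x) = c *\<^sub>C A x)"

text \<open>The definite descriptions below denote unique objects only for bounded operators: the adjoint
  (Riesz), the positive square root of a positive operator, and the polar factor.\<close>

definition adj :: "('a::chilbert_space \<Rightarrow> 'b::chilbert_space) \<Rightarrow> 'b \<Rightarrow> 'a" where
  "adj A = (THE B. bounded_clinear B \<and> (\<forall>x y. A x \<bullet>\<^sub>C y = x \<bullet>\<^sub>C B y))"

definition positive_op :: "('a::chilbert_space \<Rightarrow> 'a) \<Rightarrow> bool" where
  "positive_op P \<longleftrightarrow> bounded_clinear P \<and> (\<forall>x. x \<bullet>\<^sub>C P x \<in> \<real> \<and> 0 \<le> Re (x \<bullet>\<^sub>C P x))"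

definition sqrt_op :: "('a::chilbert_space \<Rightarrow> 'a) \<Rightarrow> 'a \<Rightarrow> 'a" where
  "sqrt_op A = (THE P. positive_op P \<and> P \<circ> P = A)"

definition abs_op :: "('a::chilbert_space \<Rightarrow> 'a) \<Rightarrow> 'a \<Rightarrow> 'a" where
  "abs_op T = sqrt_op (adj T \<circ> T)"

definition ker :: "('a::chilbert_space \<Rightarrow> 'b::chilbert_space) \<Rightarrow> 'a set" where
  "ker A = {x. A x = 0}"

definition orth_compl :: "'a::chilbert_space set \<Rightarrow> 'a set" where
  "orth_compl M = {x. \<forall>y\<in>M. x \<bullet>\<^sub>C y = 0}"

definition partial_isometry :: "('a::chilbert_space \<Rightarrow> 'b::chilbert_space) \<Rightarrow> bool" where
  "partial_isometry U \<longleftrightarrow> bounded_clinear U \<and> (\<forall>x\<in>orth_compl (ker U). norm (U x) = norm x)"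

definition isometry_op :: "('a::chilbert_space \<Rightarrow> 'b::chilbert_space) \<Rightarrow> bool" where
  "isometry_op W \<longleftrightarrow> bounded_clinear W \<and> (\<forall>x. norm (W x) = norm x)"

definition unitary_op :: "('a::chilbert_space \<Rightarrow> 'b::chilbert_space) \<Rightarrow> bool" where
  "unitary_op V \<longleftrightarrow> bounded_clinear V \<and> adj V \<circ> V = id \<and> V \<circ> adj V = id"

definition polar_factor :: "('a::chilbert_space \<Rightarrow> 'a) \<Rightarrow> 'a \<Rightarrow> 'a" where
  "polar_factor T = (THE U. partial_isometry U \<and> ker U = ker T \<and> T = U \<circ> abs_op T)"

definition duggal :: "('a::chilbert_space \<Rightarrow> 'a) \<Rightarrow> 'a \<Rightarrow> 'a" where
  "duggal T = abs_op T \<circ> polar_factor T"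

definition mean_transform :: "real \<Rightarrow> ('a::chilbert_space \<Rightarrow> 'a) \<Rightarrow> 'a \<Rightarrow> 'a" where
  "mean_transform l T = (\<lambda>x. l *\<^sub>R T x + (1 - l) *\<^sub>R duggal T x)"

definition dilates :: "('b::chilbert_space \<Rightarrow> 'b) \<Rightarrow> ('a::chilbert_space \<Rightarrow> 'a) \<Rightarrow> bool" where
  "dilates B A \<longleftrightarrow> (\<exists>W :: 'a \<Rightarrow> 'b. isometry_op W \<and> A = adj W \<circ> B \<circ> W)"


section \<open>Orthonormal bases\<close>

definition orthonormal :: "'a::complex_inner set \<Rightarrow> bool" where
  "orthonormal B \<longleftrightarrow> (\<forall>x\<in>B. \<forall>y\<in>B. x \<bullet>\<^sub>C y = (if x = y then 1 else 0))"

definition onb :: "'a::complex_inner set" where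
  "onb = (SOME B. orthonormal B \<and> (\<forall>C. orthonormal C \<longrightarrow> B \<subseteq> C \<longrightarrow> C = B))"

lemma onb_maximal:
  shows orthonormal_onb: "orthonormal (onb :: 'a::complex_inner set)"
    and "\<And>C. orthonormal C \<Longrightarrow> (onb :: 'a set) \<subseteq> C \<Longrightarrow> C = onb"
proof -
  have "\<exists>M\<in>{B :: 'a set. orthonormal B}. \<forall>X\<in>{B. orthonormal B}. M \<subseteq> X \<longrightarrow> X = M"
  proof (rule subset_Zorn')
    fix \<C> :: "'a set set"
    assume chain: "subset.chain {B. orthonormal B} \<C>"
    have "orthonormal (\<Union>\<C>)"
      unfolding orthonormal_def
    proof (intro ballI)
      fix x y assume "x \<in> \<Union>\<C>" "y \<in> \<Union>\<C>"
      then obtain X Y where XY: "X \<in> \<C>" "Y \<in> \<C>" "x \<in> X" "y \<in> Y" by blast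
      with chain have "X \<subseteq> Y \<or> Y \<subseteq> X" and "orthonormal X" "orthonormal Y"
        by (auto simp: subset_chain_def)
      then obtain Z where "orthonormal Z" "x \<in> Z" "y \<in> Z"
        using XY by blast
      then show "x \<bullet>\<^sub>C y = (if x = y then 1 else 0)"
        by (simp add: orthonormal_def)
    qed
    then show "\<Union>\<C> \<in> {B. orthonormal B}" by simp
  qed
  then have "\<exists>B :: 'a set. orthonormal B \<and> (\<forall>C. orthonormal C \<longrightarrow> B \<subseteq> C \<longrightarrow> C = B)"
    by blast
  from someI_ex[OF this, folded onb_def]
  show "orthonormal (onb :: 'a set)"
    and "\<And>C. orthonormal C \<Longrightarrow> (onb :: 'a set) \<subseteq> C \<Longrightarrow> C = onb"
    by blast+
qed

lemma onb_cinner: "b \<in> onb \<Longrightarrow> c \<in> onb \<Longrightarrow> b \<bullet>\<^sub>C c = (if b = c then 1 else 0)"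
  using orthonormal_onb by (auto simp: orthonormal_def)

lemma onb_total:
  fixes x :: "'a::complex_inner"
  assumes "\<And>b. b \<in> onb \<Longrightarrow> b \<bullet>\<^sub>C x = 0"
  shows "x = 0"
proof (rule ccontr)
  assume "x \<noteq> 0"
  define u where "u = complex_of_real (inverse (norm x)) *\<^sub>C x"
  have u: "norm u = 1"
    using \<open>x \<noteq> 0\<close> by (simp add: u_def norm_scaleC norm_inverse)
  have bu: "b \<bullet>\<^sub>C u = 0 \<and> u \<bullet>\<^sub>C b = 0" if "b \<in> onb" for b
    using assms[OF that] cinner_commute[of x b]
    by (simp add: u_def cinner_scaleC_left cinner_scaleC_right)
  have "u \<notin> onb"
    using bu[of u] u by (auto simp: cinner_self)
  have "orthonormal (insert u onb)"
    unfolding orthonormal_def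
  proof (intro ballI)
    fix b c assume "b \<in> insert u onb" "c \<in> insert u onb"
    then show "b \<bullet>\<^sub>C c = (if b = c then 1 else 0)"
      using bu u \<open>u \<notin> onb\<close> onb_cinner[of b c] by (cases "b = u"; cases "c = u") (simp_all add: cinner_self)
  qed
  then have "u \<in> onb"
    using onb_maximal(2)[of "insert u onb"] by blast
  with \<open>u \<notin> onb\<close> show False by blast
qed

lemma norm_sum_onb:
  assumes "finite F" "F \<subseteq> onb"
  shows "(norm (\<Sum>b\<in>F. a b *\<^sub>C b))\<^sup>2 = (\<Sum>b\<in>F. (cmod (a b))\<^sup>2)"
proof -
  have "complex_of_real ((norm (\<Sum>b\<in>F. a b *\<^sub>C b))\<^sup>2)
      = (\<Sum>b\<in>F. \<Sum>c\<in>F. cnj (a b) * (a c * (b \<bullet>\<^sub>C c)))"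
    by (simp add: cinner_self[symmetric] cinner_sum_left cinner_sum_right cinner_scaleC_left
        cinner_scaleC_right sum_distrib_left del: of_real_power)
       (subst sum.swap, simp add: ac_simps)
  also have "\<dots> = (\<Sum>b\<in>F. \<Sum>c\<in>F. if b = c then cnj (a b) * a c else 0)"
    using assms(2) by (intro sum.cong refl) (auto simp: onb_cinner subset_iff)
  also have "\<dots> = (\<Sum>b\<in>F. cnj (a b) * a b)"
    using assms(1) by simp
  also have "\<dots> = complex_of_real (\<Sum>b\<in>F. (cmod (a b))\<^sup>2)"
    unfolding of_real_sum by (intro sum.cong refl) (metis complex_norm_square mult.commute)
  finally show ?thesis
    using of_real_eq_iff by blast
qed

lemma bessel_diff:
  assumes "finite F" "F \<subseteq> onb"
  shows "(norm (x - (\<Sum>b\<in>F. (b \<bullet>\<^sub>C x) *\<^sub>C b)))\<^sup>2 = (norm x)\<^sup>2 - (\<Sum>b\<in>F. (cmod (b \<bullet>\<^sub>C x))\<^sup>2)"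
proof -
  define p where "p = (\<Sum>b\<in>F. (b \<bullet>\<^sub>C x) *\<^sub>C b)"
  have "x \<bullet>\<^sub>C p = complex_of_real (\<Sum>b\<in>F. (cmod (b \<bullet>\<^sub>C x))\<^sup>2)"
    unfolding p_def cinner_sum_right of_real_sum cinner_scaleC_right
    by (intro sum.cong refl) (metis complex_norm_square cinner_commute)
  then have "inner x p = (norm p)\<^sup>2"
    using norm_sum_onb[OF assms, of "\<lambda>b. b \<bullet>\<^sub>C x"]
    by (simp add: inner_eq_Re_cinner p_def del: of_real_sum)
  then have "(norm (x - p))\<^sup>2 = (norm x)\<^sup>2 - (norm p)\<^sup>2"
    by (simp add: power2_norm_eq_inner inner_diff_left inner_diff_right inner_commute)
  then show ?thesis
    using norm_sum_onb[OF assms, of "\<lambda>b. b \<bullet>\<^sub>C x"] by (simp add: p_def)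
qed

lemma bessel_summable:
  fixes x :: "'a::complex_inner"
  shows "(\<lambda>b. (cmod (b \<bullet>\<^sub>C x))\<^sup>2) summable_on onb"
proof (rule nonneg_bdd_above_summable_on)
  show "bdd_above (sum (\<lambda>b. (cmod (b \<bullet>\<^sub>C x))\<^sup>2) ` {F. F \<subseteq> onb \<and> finite F})"
  proof (rule bdd_aboveI2)
    fix F assume "F \<in> {F. F \<subseteq> (onb :: 'a set) \<and> finite F}"
    then show "(\<Sum>b\<in>F. (cmod (b \<bullet>\<^sub>C x))\<^sup>2) \<le> (norm x)\<^sup>2"
      using bessel_diff[of F x] zero_le_power2[of "norm (x - (\<Sum>b\<in>F. (b \<bullet>\<^sub>C x) *\<^sub>C b))"]
      by simp
  qed
qed simp

lemma onb_summable:
  fixes a :: "'a::chilbert_space \<Rightarrow> complex"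
  assumes "(\<lambda>b. (cmod (a b))\<^sup>2) summable_on onb"
  shows "(\<lambda>b. a b *\<^sub>C b) summable_on onb"
proof -
  define s where "s = (\<lambda>F. \<Sum>b\<in>F. a b *\<^sub>C b)"
  define q where "q = (\<lambda>F. \<Sum>b\<in>F. (cmod (a b))\<^sup>2)"
  obtain L where L: "(q \<longlongrightarrow> L) (finite_subsets_at_top onb)"
    using assms unfolding summable_on_def has_sum_def q_def by blast
  have "\<exists>P. eventually P (finite_subsets_at_top onb) \<and>
              (\<forall>F G. P F \<and> P G \<longrightarrow> dist (s F) (s G) < e)" if "e > 0" for e
  proof -
    define d where "d = (e / 2)\<^sup>2 / 4"
    have "d > 0" using that by (simp add: d_def)
    then have "\<forall>\<^sub>F F in finite_subsets_at_top onb. dist (q F) L < d"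
      using L by (simp add: tendstoD)
    then obtain H where H12: "finite H" "H \<subseteq> onb"
        and "\<forall>F. finite F \<and> H \<subseteq> F \<and> F \<subseteq> onb \<longrightarrow> dist (q F) L < d"
      unfolding eventually_finite_subsets_at_top by auto
    then have H3: "dist (q F) L < d" if "finite F" "H \<subseteq> F" "F \<subseteq> onb" for F
      using that by simp
    define P where "P F \<longleftrightarrow> finite F \<and> H \<subseteq> F \<and> F \<subseteq> onb" for F
    have near: "dist (s F) (s H) < e / 2" if "P F" for F
    proof -
      have F: "finite F" "H \<subseteq> F" "F \<subseteq> onb" using that by (auto simp: P_def)
      have "s F - s H = (\<Sum>b\<in>F - H. a b *\<^sub>C b)"
        unfolding s_def using F H12(1) by (simp add: sum_diff)
      then have "(norm (s F - s H))\<^sup>2 = (\<Sum>b\<in>F - H. (cmod (a b))\<^sup>2)"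
        using norm_sum_onb[of "F - H" a] F by auto
      also have "\<dots> = q F - q H"
        unfolding q_def using F H12(1) by (simp add: sum_diff)
      also have "\<dots> < 4 * d"
        using H3[OF F] H3[OF H12(1) order_refl H12(2)] \<open>d > 0\<close>
        unfolding dist_real_def by linarith
      also have "\<dots> = (e / 2)\<^sup>2"
        by (simp add: d_def)
      finally have "norm (s F - s H) < e / 2"
        using \<open>e > 0\<close> by (intro power_less_imp_less_base[of _ 2 "e / 2"]) auto
      then show ?thesis
        by (simp only: dist_norm)
    qed
    have "eventually P (finite_subsets_at_top onb)"
      unfolding eventually_finite_subsets_at_top P_def using H12 by (intro exI[of _ H]) simp
    moreover have "dist (s F) (s G) < e" if "P F" "P G" for F G
      using near[OF that(1)] near[OF that(2)] dist_triangle2[of "s F" "s G" "s H"] by linarith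
    ultimately show ?thesis by blast
  qed
  then have "cauchy_filter (filtermap s (finite_subsets_at_top onb))"
    by (simp add: cauchy_filter_metric_filtermap)
  moreover have "complete (UNIV :: 'a set)"
    by (meson Cauchy_convergent UNIV_I complete_def convergent_def)
  ultimately obtain z where "(s \<longlongrightarrow> z) (finite_subsets_at_top onb)"
    using complete_uniform[where S = "UNIV :: 'a set"] by (force simp add: filterlim_def)
  then show ?thesis
    using summable_on_def has_sum_def s_def by blast
qed

lemma onb_expansion:
  fixes x :: "'a::chilbert_space"
  shows "((\<lambda>b. (b \<bullet>\<^sub>C x) *\<^sub>C b) has_sum x) onb"
proof -
  obtain z where z: "((\<lambda>b. (b \<bullet>\<^sub>C x) *\<^sub>C b) has_sum z) onb"
    using onb_summable[OF bessel_summable[of x]] by (auto simp: summable_on_def)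
  have "x - z = 0"
  proof (rule onb_total)
    fix c :: 'a assume c: "c \<in> onb"
    have "((\<lambda>b. c \<bullet>\<^sub>C ((b \<bullet>\<^sub>C x) *\<^sub>C b)) has_sum (c \<bullet>\<^sub>C z)) onb"
      by (rule has_sum_bounded_linear[OF bounded_linear_cinner_right z])
    moreover have "((\<lambda>b. c \<bullet>\<^sub>C ((b \<bullet>\<^sub>C x) *\<^sub>C b)) has_sum (c \<bullet>\<^sub>C x)) onb"
    proof (rule has_sum_finite_neutralI[where B = "{c}"])
      show "c \<bullet>\<^sub>C x = (\<Sum>b\<in>{c}. c \<bullet>\<^sub>C ((b \<bullet>\<^sub>C x) *\<^sub>C b))"
        using c by (simp add: cinner_scaleC_right onb_cinner)
    qed (use c in \<open>auto simp: cinner_scaleC_right onb_cinner\<close>)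
    ultimately have "c \<bullet>\<^sub>C z = c \<bullet>\<^sub>C x"
      using has_sum_unique by blast
    then show "c \<bullet>\<^sub>C (x - z) = 0"
      by (simp add: cinner_diff_right)
  qed
  with z show ?thesis by simp
qed

lemma parseval:
  fixes x y :: "'a::chilbert_space"
  shows "((\<lambda>b. cnj (b \<bullet>\<^sub>C x) * (b \<bullet>\<^sub>C y)) has_sum (x \<bullet>\<^sub>C y)) onb"
proof -
  have "((\<lambda>b. x \<bullet>\<^sub>C ((b \<bullet>\<^sub>C y) *\<^sub>C b)) has_sum (x \<bullet>\<^sub>C y)) onb"
    by (rule has_sum_bounded_linear[OF bounded_linear_cinner_right onb_expansion])
  then show ?thesis
    by (simp add: cinner_scaleC_right cinner_commute[of x] mult.commute)
qed

section \<open>Square-summable families\<close>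

definition square_summable :: "('i \<Rightarrow> complex) \<Rightarrow> bool" where
  "square_summable f \<longleftrightarrow> (\<lambda>i. (cmod (f i))\<^sup>2) summable_on UNIV"

lemma square_summableI:
  assumes "\<And>F. finite F \<Longrightarrow> (\<Sum>i\<in>F. (cmod (f i))\<^sup>2) \<le> M"
  shows "square_summable f"
  unfolding square_summable_def
  by (rule nonneg_bdd_above_summable_on) (use assms in \<open>auto intro!: bdd_aboveI2[where M = M]\<close>)

lemma square_summable_add:
  assumes "square_summable f" "square_summable g"
  shows "square_summable (\<lambda>i. f i + g i)"
proof -
  have "(\<lambda>i. 2 * (cmod (f i))\<^sup>2 + 2 * (cmod (g i))\<^sup>2) summable_on UNIV"
    using assms unfolding square_summable_def by (intro summable_on_add summable_on_cmult_right)
  moreover have "(cmod (f i + g i))\<^sup>2 \<le> 2 * (cmod (f i))\<^sup>2 + 2 * (cmod (g i))\<^sup>2" for i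
  proof -
    have "(cmod (f i + g i))\<^sup>2 \<le> (cmod (f i) + cmod (g i))\<^sup>2"
      by (intro power_mono norm_triangle_ineq norm_ge_zero)
    also have "\<dots> \<le> 2 * (cmod (f i))\<^sup>2 + 2 * (cmod (g i))\<^sup>2"
      using zero_le_power2[of "cmod (f i) - cmod (g i)"]
      unfolding power2_sum power2_diff by linarith
    finally show ?thesis .
  qed
  ultimately show ?thesis
    unfolding square_summable_def by (rule summable_on_comparison_test) auto
qed

lemma square_summable_scale:
  assumes "square_summable f"
  shows "square_summable (\<lambda>i. c * f i)"
  using assms summable_on_cmult_right[of "\<lambda>i. (cmod (f i))\<^sup>2" UNIV "(cmod c)\<^sup>2"]
  unfolding square_summable_def by (simp add: norm_mult power_mult_distrib)

lemma square_summable_zero: "square_summable (\<lambda>i. 0)"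
  unfolding square_summable_def by simp

lemma square_summable_mult:
  assumes "square_summable f" "square_summable g"
  shows "(\<lambda>i. cnj (f i) * g i) summable_on UNIV"
proof (rule Infinite_Sum.abs_summable_summable, rule Infinite_Sum.abs_summable_on_comparison_test')
  show "(\<lambda>i. (cmod (f i))\<^sup>2 + (cmod (g i))\<^sup>2) summable_on UNIV"
    using assms unfolding square_summable_def by (rule summable_on_add)
  show "cmod (cnj (f i) * g i) \<le> (cmod (f i))\<^sup>2 + (cmod (g i))\<^sup>2" for i
  proof -
    have "2 * (cmod (f i) * cmod (g i)) \<le> (cmod (f i))\<^sup>2 + (cmod (g i))\<^sup>2"
      using zero_le_power2[of "cmod (f i) - cmod (g i)"] unfolding power2_diff by linarith
    moreover have "0 \<le> cmod (f i) * cmod (g i)"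
      by simp
    ultimately show ?thesis
      unfolding norm_mult complex_mod_cnj by linarith
  qed
qed

lemma infsum_cnj_mult_self:
  assumes "square_summable f"
  shows "(\<Sum>\<^sub>\<infinity>i. cnj (f i) * f i) = complex_of_real (\<Sum>\<^sub>\<infinity>i. (cmod (f i))\<^sup>2)"
proof (rule infsumI)
  have "cnj (f i) * f i = complex_of_real ((cmod (f i))\<^sup>2)" for i
    by (metis complex_norm_square mult.commute)
  moreover have "((\<lambda>i. complex_of_real ((cmod (f i))\<^sup>2)) has_sum
      complex_of_real (\<Sum>\<^sub>\<infinity>i. (cmod (f i))\<^sup>2)) UNIV"
    using assms unfolding square_summable_def
    by (intro has_sum_bounded_linear[OF bounded_linear_of_real]) simp
  ultimately show "((\<lambda>i. cnj (f i) * f i) has_sum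
      complex_of_real (\<Sum>\<^sub>\<infinity>i. (cmod (f i))\<^sup>2)) UNIV"
    by simp
qed


section \<open>Hilbert space tensor product\<close>

text \<open>The Hilbert space tensor product is realised by coordinates: square-summable families indexed
  by the product of orthonormal bases of the factors. It is characterised, independently of the
  chosen bases, by the lemmas \<open>tensor_add_left\<close> to \<open>tensor_total\<close> below: \<open>x \<otimes> y\<close> is
  bilinear in \<open>x\<close> and \<open>y\<close>, satisfies
  \<open>(x \<otimes> y) \<bullet>\<^sub>C (x' \<otimes> y') = (x \<bullet>\<^sub>C x') * (y \<bullet>\<^sub>C y')\<close>, and the simple tensors span a dense subspace.\<close>

typedef (overloaded) ('a::chilbert_space, 'b::chilbert_space) htensor (infixr "\<otimes>" 20) =
  "{f :: 'a \<times> 'b \<Rightarrow> complex. square_summable f \<and> (\<forall>i. i \<notin> onb \<times> onb \<longrightarrow> f i = 0)}"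
  morphisms coord Abs_htensor
  by (rule exI[of _ "\<lambda>i. 0"]) (simp add: square_summable_zero)

setup_lifting type_definition_htensor

lemma coord_square_summable: "square_summable (coord u)"
  using coord[of u] by simp

lemma coord_outside: "i \<notin> onb \<times> onb \<Longrightarrow> coord u i = 0"
  using coord[of u] by blast

instantiation htensor :: (chilbert_space, chilbert_space) complex_vector
begin

lift_definition zero_htensor :: "'a \<otimes> 'b" is "\<lambda>i. 0"
  by (simp add: square_summable_zero)

lift_definition plus_htensor :: "'a \<otimes> 'b \<Rightarrow> 'a \<otimes> 'b \<Rightarrow> 'a \<otimes> 'b" is "\<lambda>f g i. f i + g i"
  by (simp add: square_summable_add)

lift_definition scaleC_htensor :: "complex \<Rightarrow> 'a \<otimes> 'b \<Rightarrow> 'a \<otimes> 'b" is "\<lambda>c f i. c * f i"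
  by (simp add: square_summable_scale)

definition scaleR_htensor :: "real \<Rightarrow> 'a \<otimes> 'b \<Rightarrow> 'a \<otimes> 'b" where
  "scaleR_htensor r u = complex_of_real r *\<^sub>C u"

definition uminus_htensor :: "'a \<otimes> 'b \<Rightarrow> 'a \<otimes> 'b" where
  "uminus_htensor u = (- 1) *\<^sub>C u"

definition minus_htensor :: "'a \<otimes> 'b \<Rightarrow> 'a \<otimes> 'b \<Rightarrow> 'a \<otimes> 'b" where
  "minus_htensor u v = u + - v"

instance
proof
  fix u v w :: "'a \<otimes> 'b" and a b :: complex and r s :: real
  show "u + v + w = u + (v + w)" by transfer (simp add: add.assoc)
  show "u + v = v + u" by transfer (simp add: add.commute)
  show "0 + u = u" by transfer simp
  show "- u + u = 0" unfolding uminus_htensor_def by transfer simp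
  show "u - v = u + - v" by (rule minus_htensor_def)
  show scaleC_add: "a *\<^sub>C (u + v) = a *\<^sub>C u + a *\<^sub>C v" for a and u v :: "'a \<otimes> 'b"
    by (simp add: coord_inject[symmetric] fun_eq_iff plus_htensor.rep_eq scaleC_htensor.rep_eq distrib_left)
  show add_scaleC: "(a + b) *\<^sub>C u = a *\<^sub>C u + b *\<^sub>C u" for a b and u :: "'a \<otimes> 'b"
    by (simp add: coord_inject[symmetric] fun_eq_iff plus_htensor.rep_eq scaleC_htensor.rep_eq distrib_right)
  show scaleC: "a *\<^sub>C (b *\<^sub>C u) = (a * b) *\<^sub>C u" for a b and u :: "'a \<otimes> 'b"
    by (simp add: coord_inject[symmetric] fun_eq_iff plus_htensor.rep_eq scaleC_htensor.rep_eq mult.assoc)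
  show "r *\<^sub>R u = complex_of_real r *\<^sub>C u" by (rule scaleR_htensor_def)
  show "r *\<^sub>R (u + v) = r *\<^sub>R u + r *\<^sub>R v" by (simp add: scaleR_htensor_def scaleC_add)
  show "(r + s) *\<^sub>R u = r *\<^sub>R u + s *\<^sub>R u" by (simp add: scaleR_htensor_def add_scaleC)
  show "r *\<^sub>R (s *\<^sub>R u) = (r * s) *\<^sub>R u" by (simp add: scaleR_htensor_def scaleC)
  show "1 *\<^sub>R u = u" unfolding scaleR_htensor_def by transfer simp
qed

end

instantiation htensor :: (chilbert_space, chilbert_space) complex_inner
begin

definition cinner_htensor :: "'a \<otimes> 'b \<Rightarrow> 'a \<otimes> 'b \<Rightarrow> complex" where
  "cinner_htensor u v = (\<Sum>\<^sub>\<infinity>i. cnj (coord u i) * coord v i)"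

definition inner_htensor :: "'a \<otimes> 'b \<Rightarrow> 'a \<otimes> 'b \<Rightarrow> real" where
  "inner_htensor u v = Re (u \<bullet>\<^sub>C v)"

definition norm_htensor :: "'a \<otimes> 'b \<Rightarrow> real" where
  "norm_htensor u = sqrt (inner u u)"

definition sgn_htensor :: "'a \<otimes> 'b \<Rightarrow> 'a \<otimes> 'b" where
  "sgn_htensor u = u /\<^sub>R norm u"

definition dist_htensor :: "'a \<otimes> 'b \<Rightarrow> 'a \<otimes> 'b \<Rightarrow> real" where
  "dist_htensor u v = norm (u - v)"

definition uniformity_htensor :: "(('a \<otimes> 'b) \<times> ('a \<otimes> 'b)) filter" where
  "uniformity_htensor = (INF e\<in>{0<..}. principal {(u, v). dist u v < e})"

definition open_htensor :: "('a \<otimes> 'b) set \<Rightarrow> bool" where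
  "open_htensor U = (\<forall>u\<in>U. \<forall>\<^sub>F (u', v) in uniformity. u' = u \<longrightarrow> v \<in> U)"

instance
proof
  fix u v w :: "'a \<otimes> 'b" and a :: complex and r :: real
  have summ: "(\<lambda>i. cnj (coord u i) * coord v i) summable_on UNIV" for u v :: "'a \<otimes> 'b"
    by (intro square_summable_mult coord_square_summable)
  show comm: "u \<bullet>\<^sub>C v = cnj (v \<bullet>\<^sub>C u)" for u v :: "'a \<otimes> 'b"
    unfolding cinner_htensor_def infsum_cnj[symmetric] by (simp add: mult.commute)
  show add: "u \<bullet>\<^sub>C (v + w) = u \<bullet>\<^sub>C v + u \<bullet>\<^sub>C w" for u v w :: "'a \<otimes> 'b"
    unfolding cinner_htensor_def plus_htensor.rep_eq distrib_left
    by (rule infsum_add[OF summ summ])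
  show scale: "u \<bullet>\<^sub>C (a *\<^sub>C v) = a * (u \<bullet>\<^sub>C v)" for u v :: "'a \<otimes> 'b" and a
    unfolding cinner_htensor_def scaleC_htensor.rep_eq mult.left_commute[of _ a]
    by (rule infsum_cmult_right')
  show "inner u v = Re (u \<bullet>\<^sub>C v)" by (rule inner_htensor_def)
  show inner_comm: "inner u v = inner v u" for u v :: "'a \<otimes> 'b"
    using comm[of u v] by (simp add: inner_htensor_def)
  show "inner (u + v) w = inner u w + inner v w"
    using add[of w u v] comm[of w "u + v"] comm[of w u] comm[of w v]
    by (simp add: inner_htensor_def complex_eq_iff)
  show "inner (r *\<^sub>R u) v = r * inner u v"
    unfolding inner_comm[of _ v] by (simp add: inner_htensor_def scaleR_htensor_def scale)
  have self: "u \<bullet>\<^sub>C u = complex_of_real (\<Sum>\<^sub>\<infinity>i. (cmod (coord u i))\<^sup>2)"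
    unfolding cinner_htensor_def by (rule infsum_cnj_mult_self[OF coord_square_summable])
  show "0 \<le> inner u u"
    unfolding inner_htensor_def self by (simp add: infsum_nonneg)
  show "(inner u u = 0) = (u = 0)"
  proof
    assume "inner u u = 0"
    then have 0: "(\<Sum>\<^sub>\<infinity>i. (cmod (coord u i))\<^sup>2) = 0"
      by (simp add: inner_htensor_def self)
    have "(cmod (coord u i))\<^sup>2 = 0" for i
      by (rule nonneg_infsum_le_0D[where A = UNIV])
        (use 0 coord_square_summable[of u] in \<open>auto simp: square_summable_def\<close>)
    then have "coord u = coord 0"
      by (auto simp: zero_htensor.rep_eq)
    then show "u = 0"
      by (simp add: coord_inject)
  next
    assume "u = 0"
    then show "inner u u = 0"
      unfolding inner_htensor_def self by (simp add: zero_htensor.rep_eq)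
  qed
  show "norm u = sqrt (inner u u)" by (rule norm_htensor_def)
  show "sgn u = u /\<^sub>R norm u" by (rule sgn_htensor_def)
  show "dist u v = norm (u - v)" by (rule dist_htensor_def)
  show "uniformity = (INF e\<in>{0<..}. principal {(u :: 'a \<otimes> 'b, v). dist u v < e})"
    by (rule uniformity_htensor_def)
  show "open U = (\<forall>u\<in>U. \<forall>\<^sub>F (u', v) in uniformity. u' = u \<longrightarrow> v \<in> U)" for U :: "('a \<otimes> 'b) set"
    by (rule open_htensor_def)
qed

end

lemma coord_diff: "coord (u - v) i = coord u i - coord v i"
  by (simp add: minus_htensor_def uminus_htensor_def plus_htensor.rep_eq scaleC_htensor.rep_eq)

lemma norm_htensor_square:
  fixes u :: "'a::chilbert_space \<otimes> 'b::chilbert_space"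
  shows "((\<lambda>i. (cmod (coord u i))\<^sup>2) has_sum (norm u)\<^sup>2) UNIV"
proof -
  have "u \<bullet>\<^sub>C u = complex_of_real (\<Sum>\<^sub>\<infinity>i. (cmod (coord u i))\<^sup>2)"
    unfolding cinner_htensor_def by (rule infsum_cnj_mult_self[OF coord_square_summable])
  then have "(norm u)\<^sup>2 = (\<Sum>\<^sub>\<infinity>i. (cmod (coord u i))\<^sup>2)"
    unfolding cinner_self using of_real_eq_iff by blast
  then show ?thesis
    using coord_square_summable[of u] by (simp add: square_summable_def)
qed

lemma norm_htensor_ge:
  fixes u :: "'a::chilbert_space \<otimes> 'b::chilbert_space"
  assumes "finite F"
  shows "(\<Sum>i\<in>F. (cmod (coord u i))\<^sup>2) \<le> (norm u)\<^sup>2"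
  by (rule finite_sum_le_has_sum[OF norm_htensor_square]) (use assms in auto)

lemma norm_htensor_le:
  fixes u :: "'a::chilbert_space \<otimes> 'b::chilbert_space"
  assumes "\<And>F. finite F \<Longrightarrow> (\<Sum>i\<in>F. (cmod (coord u i))\<^sup>2) \<le> e\<^sup>2" "0 \<le> e"
  shows "norm u \<le> e"
proof (rule power2_le_imp_le[OF _ assms(2)])
  show "(norm u)\<^sup>2 \<le> e\<^sup>2"
    by (rule has_sum_le_finite_sums[OF norm_htensor_square]) (use assms in auto)
qed

instance htensor :: (chilbert_space, chilbert_space) chilbert_space
proof
  fix X :: "nat \<Rightarrow> 'a \<otimes> 'b"
  assume X: "Cauchy X"
  have "Cauchy (\<lambda>n. coord (X n) i)" for i
  proof (rule CauchyI)
    fix e :: real assume "0 < e"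
    with X obtain N where N: "\<And>m n. m \<ge> N \<Longrightarrow> n \<ge> N \<Longrightarrow> norm (X m - X n) < e"
      unfolding Cauchy_iff by blast
    have "cmod (coord (X m) i - coord (X n) i) \<le> norm (X m - X n)" for m n
      using norm_htensor_ge[of "{i}" "X m - X n"]
      by (simp add: coord_diff)
    with N show "\<exists>M. \<forall>m\<ge>M. \<forall>n\<ge>M. cmod (coord (X m) i - coord (X n) i) < e"
      by (meson le_less_trans)
  qed
  then have "\<exists>l. (\<lambda>n. coord (X n) i) \<longlonglongrightarrow> l" for i
    using Cauchy_convergent convergent_def by blast
  then obtain L where L: "(\<lambda>n. coord (X n) i) \<longlonglongrightarrow> L i" for i
    by metis
  have fin: "(\<Sum>i\<in>F. (cmod (coord (X n) i - L i))\<^sup>2) \<le> e\<^sup>2"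
    if "finite F" "n \<ge> N" "\<And>m n. m \<ge> N \<Longrightarrow> n \<ge> N \<Longrightarrow> norm (X m - X n) < e" for F n N e
  proof (rule tendsto_upperbound)
    show "(\<lambda>m. \<Sum>i\<in>F. (cmod (coord (X n) i - coord (X m) i))\<^sup>2)
        \<longlonglongrightarrow> (\<Sum>i\<in>F. (cmod (coord (X n) i - L i))\<^sup>2)"
      by (intro tendsto_intros L)
    show "\<forall>\<^sub>F m in sequentially. (\<Sum>i\<in>F. (cmod (coord (X n) i - coord (X m) i))\<^sup>2) \<le> e\<^sup>2"
      unfolding eventually_sequentially
    proof (intro exI allI impI)
      fix m assume "N \<le> m"
      have "(\<Sum>i\<in>F. (cmod (coord (X n) i - coord (X m) i))\<^sup>2) \<le> (norm (X n - X m))\<^sup>2"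
        using norm_htensor_ge[OF that(1), of "X n - X m"] by (simp add: coord_diff)
      also have "\<dots> \<le> e\<^sup>2"
        using that(3)[OF that(2) \<open>N \<le> m\<close>] by (intro power_mono) auto
      finally show "(\<Sum>i\<in>F. (cmod (coord (X n) i - coord (X m) i))\<^sup>2) \<le> e\<^sup>2" .
    qed
  qed simp
  obtain N where N: "\<And>m n. m \<ge> N \<Longrightarrow> n \<ge> N \<Longrightarrow> norm (X m - X n) < 1"
    using X unfolding Cauchy_iff by (meson zero_less_one)
  have "square_summable (\<lambda>i. coord (X N) i - L i)"
    by (rule square_summableI[of _ "1\<^sup>2"]) (rule fin[OF _ order_refl N])
  then have "square_summable (\<lambda>i. coord (X N) i + (- 1) * (coord (X N) i - L i))"
    by (intro square_summable_add square_summable_scale coord_square_summable)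
  then have "square_summable L"
    by simp
  moreover have "L i = 0" if "i \<notin> onb \<times> onb" for i
  proof -
    have "(\<lambda>n. coord (X n) i) = (\<lambda>n. 0)"
      using coord_outside[OF that] by blast
    then show ?thesis
      using L[of i] LIMSEQ_unique tendsto_const by metis
  qed
  ultimately have coord_L: "coord (Abs_htensor L) = L"
    by (intro Abs_htensor_inverse) blast
  have "X \<longlonglongrightarrow> Abs_htensor L"
  proof (rule LIMSEQ_I)
    fix e :: real assume "0 < e"
    then have "0 < e / 2" by simp
    with X obtain N where N: "\<And>m n. m \<ge> N \<Longrightarrow> n \<ge> N \<Longrightarrow> norm (X m - X n) < e / 2"
      unfolding Cauchy_iff by blast
    have "norm (X n - Abs_htensor L) \<le> e / 2" if "n \<ge> N" for n
      by (rule norm_htensor_le)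
        (use fin[OF _ that N] \<open>0 < e\<close> in \<open>simp_all add: coord_diff coord_L\<close>)
    then show "\<exists>no. \<forall>n\<ge>no. norm (X n - Abs_htensor L) < e"
      using \<open>0 < e\<close> by (intro exI[of _ N]) fastforce
  qed
  then show "convergent X"
    by (rule convergentI)
qed

lemma bessel_le:
  assumes "finite F" "F \<subseteq> onb"
  shows "(\<Sum>b\<in>F. (cmod (b \<bullet>\<^sub>C x))\<^sup>2) \<le> (norm x)\<^sup>2"
  using bessel_diff[OF assms, of x] zero_le_power2[of "norm (x - (\<Sum>b\<in>F. (b \<bullet>\<^sub>C x) *\<^sub>C b))"]
  by simp

lift_definition tensor :: "'a::chilbert_space \<Rightarrow> 'b::chilbert_space \<Rightarrow> 'a \<otimes> 'b" (infixl "\<otimes>" 75)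
  is "\<lambda>x y (b, c). if b \<in> onb \<and> c \<in> onb then (b \<bullet>\<^sub>C x) * (c \<bullet>\<^sub>C y) else 0"
proof -
  fix x :: 'a and y :: 'b
  let ?f = "\<lambda>(b, c). if b \<in> onb \<and> c \<in> onb then (b \<bullet>\<^sub>C x) * (c \<bullet>\<^sub>C y) else 0"
  have "square_summable ?f"
  proof (rule square_summableI)
    fix F :: "('a \<times> 'b) set" assume "finite F"
    define A B where "A = fst ` F \<inter> onb" and "B = snd ` F \<inter> onb"
    have AB: "finite A" "finite B" "A \<subseteq> onb" "B \<subseteq> onb"
      using \<open>finite F\<close> by (auto simp: A_def B_def)
    have "(\<Sum>i\<in>F. (cmod (?f i))\<^sup>2) = (\<Sum>i\<in>F \<inter> onb \<times> onb. (cmod (?f i))\<^sup>2)"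
      using \<open>finite F\<close> by (intro sum.mono_neutral_right) (auto split: if_splits)
    also have "\<dots> \<le> (\<Sum>i\<in>A \<times> B. (cmod (?f i))\<^sup>2)"
      using AB by (intro sum_mono2) (force simp: A_def B_def)+
    also have "\<dots> = (\<Sum>(b, c)\<in>A \<times> B. (cmod (b \<bullet>\<^sub>C x))\<^sup>2 * (cmod (c \<bullet>\<^sub>C y))\<^sup>2)"
      using AB by (intro sum.cong refl) (auto simp: norm_mult power_mult_distrib)
    also have "\<dots> = (\<Sum>b\<in>A. (cmod (b \<bullet>\<^sub>C x))\<^sup>2) * (\<Sum>c\<in>B. (cmod (c \<bullet>\<^sub>C y))\<^sup>2)"
      by (simp add: sum_product sum.cartesian_product)
    also have "\<dots> \<le> (norm x)\<^sup>2 * (norm y)\<^sup>2"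
      using AB by (intro mult_mono bessel_le) (auto intro: sum_nonneg)
    finally show "(\<Sum>i\<in>F. (cmod (?f i))\<^sup>2) \<le> (norm x)\<^sup>2 * (norm y)\<^sup>2" .
  qed
  then show "square_summable ?f \<and> (\<forall>i. i \<notin> onb \<times> onb \<longrightarrow> ?f i = 0)"
    by auto
qed

lemma tensor_add_left: "(x + x') \<otimes> y = x \<otimes> y + x' \<otimes> y"
  by (simp add: coord_inject[symmetric] fun_eq_iff plus_htensor.rep_eq tensor.rep_eq
      cinner_add_right distrib_right)

lemma tensor_add_right: "x \<otimes> (y + y') = x \<otimes> y + x \<otimes> y'"
  by (simp add: coord_inject[symmetric] fun_eq_iff plus_htensor.rep_eq tensor.rep_eq
      cinner_add_right distrib_left)

lemma tensor_scaleC_left: "(a *\<^sub>C x) \<otimes> y = a *\<^sub>C (x \<otimes> y)"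
  by (simp add: coord_inject[symmetric] fun_eq_iff scaleC_htensor.rep_eq tensor.rep_eq
      cinner_scaleC_right)

lemma tensor_scaleC_right: "x \<otimes> (a *\<^sub>C y) = a *\<^sub>C (x \<otimes> y)"
  by (simp add: coord_inject[symmetric] fun_eq_iff scaleC_htensor.rep_eq tensor.rep_eq
      cinner_scaleC_right)

lemma cinner_tensor: "(x \<otimes> y) \<bullet>\<^sub>C (x' \<otimes> y') = (x \<bullet>\<^sub>C x') * (y \<bullet>\<^sub>C y')"
proof -
  let ?g = "\<lambda>(b, c). (cnj (b \<bullet>\<^sub>C x) * (b \<bullet>\<^sub>C x')) * (cnj (c \<bullet>\<^sub>C y) * (c \<bullet>\<^sub>C y'))"
  have "((\<lambda>i. cnj (coord (x \<otimes> y) i) * coord (x' \<otimes> y') i) has_sum ((x \<otimes> y) \<bullet>\<^sub>C (x' \<otimes> y'))) UNIV"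
    unfolding cinner_htensor_def
    by (intro has_sum_infsum square_summable_mult coord_square_summable)
  moreover have "((\<lambda>i. cnj (coord (x \<otimes> y) i) * coord (x' \<otimes> y') i) has_sum s) UNIV
      \<longleftrightarrow> (?g has_sum s) (onb \<times> onb)" for s
    by (rule has_sum_cong_neutral) (auto simp: tensor.rep_eq split: if_splits)
  ultimately have "(?g has_sum ((x \<otimes> y) \<bullet>\<^sub>C (x' \<otimes> y'))) (onb \<times> onb)"
    by blast
  then have "((\<lambda>b. (cnj (b \<bullet>\<^sub>C x) * (b \<bullet>\<^sub>C x')) * (y \<bullet>\<^sub>C y')) has_sum ((x \<otimes> y) \<bullet>\<^sub>C (x' \<otimes> y'))) onb"
    by (rule has_sum_SigmaD) (simp add: has_sum_cmult_right parseval)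
  moreover have "((\<lambda>b. (cnj (b \<bullet>\<^sub>C x) * (b \<bullet>\<^sub>C x')) * (y \<bullet>\<^sub>C y')) has_sum ((x \<bullet>\<^sub>C x') * (y \<bullet>\<^sub>C y'))) onb"
    by (intro has_sum_cmult_left parseval)
  ultimately show ?thesis
    using has_sum_unique by blast
qed

lemma coord_sum: "coord (\<Sum>j\<in>F. f j) i = (\<Sum>j\<in>F. coord (f j) i)"
  by (induction F rule: infinite_finite_induct) (simp_all add: zero_htensor.rep_eq plus_htensor.rep_eq)

text \<open>The set of simple tensors is closed under complex scalars, so \<open>span\<close> (the real linear span)
  is here also the complex linear span.\<close>

lemma tensor_total:
  "closure (span (range (\<lambda>(x :: 'a::chilbert_space, y :: 'b::chilbert_space). x \<otimes> y))) = UNIV"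
proof -
  let ?S = "range (\<lambda>(x :: 'a, y :: 'b). x \<otimes> y)"
  have "\<exists>v\<in>span ?S. dist v u < e" if "e > 0" for u e
  proof -
    obtain F where F: "finite F" "dist (\<Sum>i\<in>F. (cmod (coord u i))\<^sup>2) ((norm u)\<^sup>2) \<le> (e / 2)\<^sup>2"
      using has_sum_finite_approximation[OF norm_htensor_square[of u], of "(e / 2)\<^sup>2"] \<open>e > 0\<close>
      by auto
    define G where "G = F \<inter> onb \<times> onb"
    have "finite G" using F by (simp add: G_def)
    define v where "v = (\<Sum>(b, c)\<in>G. (coord u (b, c) *\<^sub>C b) \<otimes> c)"
    have "v \<in> span ?S"
      unfolding v_def by (intro span_sum) (auto intro!: span_base)
    have "coord v (b, c) = (if (b, c) \<in> F then coord u (b, c) else 0)" for b c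
    proof -
      have "coord v (b, c) = (\<Sum>j\<in>G. if j = (b, c) then coord u j else 0)"
        unfolding v_def coord_sum
        by (intro sum.cong refl)
          (auto simp: G_def tensor.rep_eq cinner_scaleC_right onb_cinner split: if_splits)
      also have "\<dots> = (if (b, c) \<in> G then coord u (b, c) else 0)"
        using \<open>finite G\<close> by simp
      also have "\<dots> = (if (b, c) \<in> F then coord u (b, c) else 0)"
        using coord_outside[of "(b, c)" u] by (auto simp: G_def)
      finally show ?thesis .
    qed
    then have v: "coord (u - v) i = (if i \<in> F then 0 else coord u i)" for i
      by (cases i) (simp add: coord_diff)
    have "norm (u - v) \<le> e / 2"
    proof (rule norm_htensor_le)
      fix H :: "('a \<times> 'b) set" assume "finite H"
      have "(\<Sum>i\<in>H. (cmod (coord (u - v) i))\<^sup>2) = (\<Sum>i\<in>H - F. (cmod (coord u i))\<^sup>2)"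
        using \<open>finite H\<close> by (intro sum.mono_neutral_cong_right) (auto simp: v)
      also have "\<dots> = (\<Sum>i\<in>H \<union> F. (cmod (coord u i))\<^sup>2) - (\<Sum>i\<in>F. (cmod (coord u i))\<^sup>2)"
        using sum_diff[of "H \<union> F" F "\<lambda>i. (cmod (coord u i))\<^sup>2"] \<open>finite H\<close> F(1)
        by (simp add: Un_Diff)
      also have "\<dots> \<le> (norm u)\<^sup>2 - (\<Sum>i\<in>F. (cmod (coord u i))\<^sup>2)"
        using norm_htensor_ge[of "H \<union> F" u] \<open>finite H\<close> F(1) by simp
      also have "\<dots> \<le> (e / 2)\<^sup>2"
        using F(2) unfolding dist_real_def by linarith
      finally show "(\<Sum>i\<in>H. (cmod (coord (u - v) i))\<^sup>2) \<le> (e / 2)\<^sup>2" .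
    qed (use \<open>e > 0\<close> in simp)
    then have "dist v u < e"
      using \<open>e > 0\<close> by (simp add: dist_norm norm_minus_commute)
    with \<open>v \<in> span ?S\<close> show ?thesis by blast
  qed
  then have "u \<in> closure (span ?S)" for u
    unfolding closure_approachable by blast
  then show ?thesis by blast
qed

definition tensor_op ::
    "('a::chilbert_space \<Rightarrow> 'a) \<Rightarrow> ('b::chilbert_space \<Rightarrow> 'b) \<Rightarrow> 'a \<otimes> 'b \<Rightarrow> 'a \<otimes> 'b"
    (infixl "\<otimes>\<^sub>o" 75) where
  "S \<otimes>\<^sub>o T = (THE A. bounded_clinear A \<and> (\<forall>x y. A (x \<otimes> y) = S x \<otimes> T y))"

end

theory Submission
  imports Defs
begin

text \<open>The flip \<open>x \<otimes> y \<mapsto> y \<otimes> x\<close> is a unitary that conjugates \<open>S \<otimes> T\<close> into \<open>T \<otimes> S\<close>.  Adjoint,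
  absolute value and polar factor are determined by properties that are invariant under unitary
  conjugation, so the mean transform commutes with it.  As they are given by definite
  descriptions, this argument needs that each of them exists and is unique.\<close>

text \<open>The weight lies in existence. A direct comparison of two positive square roots succeeds
  when they commute, so the root of \<open>adj T \<circ> T\<close> is constructed together with a
  commutation property: whatever commutes with \<open>adj T \<circ> T\<close> commutes with that
  root. Any competing root commutes with its own square, hence with the constructed one. The polar
  factor is prescribed on the range of \<open>abs_op T\<close> only. It has to be extended by
  continuity to the closure and by zero to the orthogonal complement; describing its graph by a
  relation defers all choices until that graph is known to be total, single-valued and linear. On
  simple tensors \<open>S \<otimes> T\<close> is prescribed, but a vector has many expansions in
  simple tensors, and boundedness cannot be read off from one of them. Therefore
  \<open>S \<otimes> 1\<close> is written down in coordinates, where each slice along the second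
  basis can be estimated separately. The flip then supplies \<open>1 \<otimes> T\<close>, so it
  serves in the construction of the tensor product operator as well as in the final
  conjugation.\<close>

lemma bounded_clinearI:
  fixes A :: "'a::complex_inner \<Rightarrow> 'b::complex_inner"
  assumes "\<And>x y. A (x + y) = A x + A y"
    and "\<And>c x. A (c *\<^sub>C x) = c *\<^sub>C A x"
    and "\<And>x. norm (A x) \<le> norm x * K"
  shows "bounded_clinear A"
  unfolding bounded_clinear_def
  using assms by (auto intro!: bounded_linear_intro[where K = K] simp: scaleR_scaleC)

lemma bounded_clinear_linear: "bounded_clinear A \<Longrightarrow> linear A"
  by (simp add: bounded_clinear_def bounded_linear.linear)

lemma bounded_clinear_scaleC: "bounded_clinear A \<Longrightarrow> A (c *\<^sub>C x) = c *\<^sub>C A x"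
  by (simp add: bounded_clinear_def)

lemmas bounded_clinear_add = linear_add[OF bounded_clinear_linear]
  and bounded_clinear_diff = linear_diff[OF bounded_clinear_linear]
  and bounded_clinear_scaleR = linear_scale[OF bounded_clinear_linear]
  and bounded_clinear_sum = linear_sum[OF bounded_clinear_linear]
  and bounded_clinear_zero = linear_0[OF bounded_clinear_linear]

lemma bounded_clinear_bound:
  assumes "bounded_clinear A"
  obtains K where "K > 0" "\<And>x. norm (A x) \<le> norm x * K"
  using assms bounded_linear.pos_bounded unfolding bounded_clinear_def by blast

lemma bounded_clinear_tendsto:
  "bounded_clinear A \<Longrightarrow> (f \<longlongrightarrow> l) F \<Longrightarrow> ((\<lambda>x. A (f x)) \<longlongrightarrow> A l) F"
  by (simp add: bounded_clinear_def bounded_linear.tendsto)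

lemma bounded_clinear_compose:
  "bounded_clinear A \<Longrightarrow> bounded_clinear B \<Longrightarrow> bounded_clinear (A \<circ> B)"
  unfolding bounded_clinear_def o_def by (auto intro: bounded_linear_compose)

lemma bounded_clinear_id: "bounded_clinear (\<lambda>x. x)"
  by (simp add: bounded_clinear_def bounded_linear_ident)

lemma bounded_clinear_scaleC_op:
  fixes c :: complex
  shows "bounded_clinear (\<lambda>x::'a::complex_inner. c *\<^sub>C x)"
  by (rule bounded_clinearI[where K = "cmod c"])
    (simp_all add: scaleC_add_right scaleC_scaleC norm_scaleC mult.commute)

lemma bounded_clinear_const_zero: "bounded_clinear (\<lambda>x. 0)"
  by (rule bounded_clinearI[where K = 0]) (simp_all add: scaleC_add_right[of _ 0 0, simplified])

lemma scaleC_scaleR: "c *\<^sub>C (r *\<^sub>R x) = r *\<^sub>R (c *\<^sub>C x)"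
  by (simp add: scaleR_scaleC scaleC_scaleC mult.commute)

lemma scaleC_minus_right: "c *\<^sub>C (- x) = - (c *\<^sub>C x)"
  using scaleC_scaleR[of c "-1" x] by simp

lemma scaleC_diff_right: "c *\<^sub>C (x - y) = c *\<^sub>C x - c *\<^sub>C y"
  using scaleC_add_right[of c x "- y"] by (simp add: scaleC_minus_right)

lemma bounded_clinear_scaleR_op: "bounded_clinear A \<Longrightarrow> bounded_clinear (\<lambda>x. r *\<^sub>R A x)"
  unfolding bounded_clinear_def by (auto intro: bounded_linear_const_scaleR simp: scaleC_scaleR)

lemma bounded_clinear_add_op:
  "bounded_clinear A \<Longrightarrow> bounded_clinear B \<Longrightarrow> bounded_clinear (\<lambda>x. A x + B x)"
  unfolding bounded_clinear_def by (auto intro: bounded_linear_add simp: scaleC_add_right)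

lemma bounded_clinear_diff_op:
  "bounded_clinear A \<Longrightarrow> bounded_clinear B \<Longrightarrow> bounded_clinear (\<lambda>x. A x - B x)"
  unfolding bounded_clinear_def by (auto intro: bounded_linear_sub simp: scaleC_diff_right)

section \<open>Real scalars, nondegeneracy and continuity of the inner product\<close>

lemma cinner_scaleR_right: "x \<bullet>\<^sub>C (r *\<^sub>R y) = complex_of_real r * (x \<bullet>\<^sub>C y)"
  by (simp add: scaleR_scaleC cinner_scaleC_right)

lemma cinner_scaleR_left: "(r *\<^sub>R x) \<bullet>\<^sub>C y = complex_of_real r * (x \<bullet>\<^sub>C y)"
  by (simp add: scaleR_scaleC cinner_scaleC_left)

lemma cinner_self_eq_0: "x \<bullet>\<^sub>C x = 0 \<Longrightarrow> x = 0"
  by (simp add: cinner_self)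

lemma cinner_ext_right: "(\<And>x. x \<bullet>\<^sub>C y = x \<bullet>\<^sub>C z) \<Longrightarrow> y = z"
  using cinner_self_eq_0[of "y - z"] by (simp add: cinner_diff_right)

lemma tendsto_cinner_right: "(f \<longlongrightarrow> l) F \<Longrightarrow> ((\<lambda>n. x \<bullet>\<^sub>C f n) \<longlongrightarrow> x \<bullet>\<^sub>C l) F"
  by (rule bounded_linear.tendsto[OF bounded_linear_cinner_right])

lemma tendsto_cinner_left:
  assumes "(f \<longlongrightarrow> l) F"
  shows "((\<lambda>n. f n \<bullet>\<^sub>C x) \<longlongrightarrow> l \<bullet>\<^sub>C x) F"
proof -
  have "((\<lambda>n. cnj (x \<bullet>\<^sub>C f n)) \<longlongrightarrow> cnj (x \<bullet>\<^sub>C l)) F"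
    by (intro tendsto_cnj tendsto_cinner_right assms)
  then show ?thesis
    by (simp flip: cinner_commute)
qed


section \<open>Adjoints\<close>

text \<open>Test the adjoint relation at \<open>x = B y\<close> and cancel one factor
  \<open>norm (B y)\<close>. Linearity of \<open>B\<close> does not enter, so the bound is available
  while \<open>B\<close> is still being shown to be an operator.\<close>

lemma norm_adjoint_le:
  assumes K: "K > 0" "\<And>x. norm (A x) \<le> norm x * K"
    and B: "\<And>x y. A x \<bullet>\<^sub>C y = x \<bullet>\<^sub>C B y"
  shows "norm (B y) \<le> norm y * K"
proof (cases "B y = 0")
  case False
  have "(norm (B y))\<^sup>2 = cmod (A (B y) \<bullet>\<^sub>C y)"
    by (simp add: B cinner_self norm_power)
  also have "\<dots> \<le> norm (A (B y)) * norm y"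
    by (rule cmod_cinner_le)
  also have "\<dots> \<le> norm (B y) * (norm y * K)"
    using mult_right_mono[OF K(2)[of "B y"], of "norm y"] by (simp add: ac_simps)
  finally show ?thesis
    using False by (simp add: power2_eq_square)
qed (use K(1) in simp)

text \<open>Riesz representation in coordinates: the representing vector of
  \<open>x \<mapsto> A x \<bullet>\<^sub>C y\<close> must have the coordinates
  \<open>A b \<bullet>\<^sub>C y\<close>, so it suffices that these are square-summable.\<close>

lemma adj_exists:
  fixes A :: "'a::chilbert_space \<Rightarrow> 'b::chilbert_space"
  assumes A: "bounded_clinear A"
  shows "\<exists>B. bounded_clinear B \<and> (\<forall>x y. A x \<bullet>\<^sub>C y = x \<bullet>\<^sub>C B y)"
proof -
  obtain K where K: "K > 0" "\<And>x. norm (A x) \<le> norm x * K"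
    by (rule bounded_clinear_bound[OF A]) blast
  have "\<exists>z. \<forall>x. A x \<bullet>\<^sub>C y = x \<bullet>\<^sub>C z" for y
  proof -
    have "(\<lambda>b. (cmod (A b \<bullet>\<^sub>C y))\<^sup>2) summable_on onb"
    proof (rule nonneg_bdd_above_summable_on)
      show "bdd_above (sum (\<lambda>b. (cmod (A b \<bullet>\<^sub>C y))\<^sup>2) ` {F. F \<subseteq> onb \<and> finite F})"
      proof (rule bdd_aboveI2[where M = "(K * norm y)\<^sup>2"])
        fix F :: "'a set" assume "F \<in> {F. F \<subseteq> onb \<and> finite F}"
        then have F: "finite F" "F \<subseteq> onb" by auto
        \<comment> \<open>The test vector uses the coefficients under estimation, so that
          \<open>A v \<bullet>\<^sub>C y\<close> equals the square of \<open>norm v\<close>.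
          Cauchy-Schwarz then bounds \<open>norm v\<close> itself, uniformly in
          \<open>F\<close>.\<close>
        define v where "v = (\<Sum>b\<in>F. (A b \<bullet>\<^sub>C y) *\<^sub>C b)"
        define s where "s = (\<Sum>b\<in>F. (cmod (A b \<bullet>\<^sub>C y))\<^sup>2)"
        have v: "(norm v)\<^sup>2 = s"
          unfolding v_def s_def by (rule norm_sum_onb[OF F])
        have "A v \<bullet>\<^sub>C y = complex_of_real s"
          unfolding v_def s_def bounded_clinear_sum[OF A] cinner_sum_left of_real_sum
          by (intro sum.cong refl)
            (simp add: bounded_clinear_scaleC[OF A] cinner_scaleC_left complex_norm_square
              mult.commute del: of_real_power)
        moreover have "s \<ge> 0"
          unfolding s_def by (simp add: sum_nonneg)
        ultimately have "(norm v)\<^sup>2 \<le> norm (A v) * norm y"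
          using cmod_cinner_le[of "A v" y] v by simp
        also have "\<dots> \<le> norm v * (K * norm y)"
          using mult_right_mono[OF K(2)[of v], of "norm y"] by (simp add: mult.assoc)
        finally have "norm v \<le> K * norm y"
          using K(1) by (cases "v = 0") (simp_all add: power2_eq_square)
        then show "s \<le> (K * norm y)\<^sup>2"
          unfolding v[symmetric] by (intro power_mono) auto
      qed
    qed auto
    then obtain z where z: "((\<lambda>b. (A b \<bullet>\<^sub>C y) *\<^sub>C b) has_sum z) onb"
      using onb_summable[of "\<lambda>b. A b \<bullet>\<^sub>C y"] by (auto simp: summable_on_def)
    have "A x \<bullet>\<^sub>C y = x \<bullet>\<^sub>C z" for x
    proof -
      have "((\<lambda>b. A ((b \<bullet>\<^sub>C x) *\<^sub>C b)) has_sum A x) onb"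
        by (rule has_sum_bounded_linear[OF _ onb_expansion])
          (use A in \<open>simp add: bounded_clinear_def\<close>)
      then have "((\<lambda>b. y \<bullet>\<^sub>C A ((b \<bullet>\<^sub>C x) *\<^sub>C b)) has_sum (y \<bullet>\<^sub>C A x)) onb"
        by (rule has_sum_bounded_linear[OF bounded_linear_cinner_right])
      \<comment> \<open>The inner product is linear in its second argument only; sums pass through
        the first argument by conjugating.\<close>
      then have "((\<lambda>b. cnj (y \<bullet>\<^sub>C A ((b \<bullet>\<^sub>C x) *\<^sub>C b))) has_sum cnj (y \<bullet>\<^sub>C A x)) onb"
        by (simp only: has_sum_cnj_iff)
      then have "((\<lambda>b. (A b \<bullet>\<^sub>C y) * (x \<bullet>\<^sub>C b)) has_sum (A x \<bullet>\<^sub>C y)) onb"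
        by (simp add: bounded_clinear_scaleC[OF A] cinner_scaleC_right
            cinner_commute[of y] cinner_commute[of x] mult.commute)
      moreover have "((\<lambda>b. (A b \<bullet>\<^sub>C y) * (x \<bullet>\<^sub>C b)) has_sum (x \<bullet>\<^sub>C z)) onb"
        using has_sum_bounded_linear[OF bounded_linear_cinner_right z, of x]
        by (simp add: cinner_scaleC_right)
      ultimately show ?thesis
        by (rule has_sum_unique)
    qed
    then show ?thesis by blast
  qed
  then obtain B where B: "\<And>x y. A x \<bullet>\<^sub>C y = x \<bullet>\<^sub>C B y"
    by metis
  have "bounded_clinear B"
  proof (rule bounded_clinearI[where K = K])
    show "B (x + y) = B x + B y" for x y
      by (rule cinner_ext_right) (simp add: B[symmetric] cinner_add_right)
    show "B (c *\<^sub>C x) = c *\<^sub>C B x" for c x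
      by (rule cinner_ext_right) (simp add: B[symmetric] cinner_scaleC_right)
    show "norm (B y) \<le> norm y * K" for y
      by (rule norm_adjoint_le[OF K B])
  qed
  with B show ?thesis by blast
qed

lemma adj_unique:
  assumes "bounded_clinear B" "\<And>x y. A x \<bullet>\<^sub>C y = x \<bullet>\<^sub>C B y"
  shows "adj A = B"
  unfolding adj_def
proof (rule the_equality)
  fix C assume C: "bounded_clinear C \<and> (\<forall>x y. A x \<bullet>\<^sub>C y = x \<bullet>\<^sub>C C y)"
  show "C = B"
  proof (rule ext, rule cinner_ext_right)
    show "x \<bullet>\<^sub>C C y = x \<bullet>\<^sub>C B y" for x y
      using C by (simp flip: assms(2))
  qed
qed (simp add: assms)

lemma adj_props:
  assumes "bounded_clinear A"
  shows bounded_clinear_adj: "bounded_clinear (adj A)"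
    and cinner_adj_right: "x \<bullet>\<^sub>C adj A y = A x \<bullet>\<^sub>C y"
proof -
  obtain B where B: "bounded_clinear B" "\<And>x y. A x \<bullet>\<^sub>C y = x \<bullet>\<^sub>C B y"
    using adj_exists[OF assms] by blast
  then have "adj A = B"
    by (rule adj_unique)
  with B show "bounded_clinear (adj A)" "x \<bullet>\<^sub>C adj A y = A x \<bullet>\<^sub>C y"
    by simp_all
qed

lemma cinner_adj_left:
  assumes "bounded_clinear A"
  shows "adj A x \<bullet>\<^sub>C y = x \<bullet>\<^sub>C A y"
  using cinner_adj_right[OF assms, of y x] cinner_commute[of "adj A x" y] cinner_commute[of x "A y"]
  by simp

lemma adj_adj: "bounded_clinear A \<Longrightarrow> adj (adj A) = A"
  by (rule adj_unique) (simp_all add: cinner_adj_left)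

section \<open>Positive square roots\<close>

text \<open>The iterates converge to a solution \<open>Y\<close> of \<open>2 Y = X + Y\<^sup>2\<close>, so that
  \<open>(1 - Y)\<^sup>2 = 1 - X\<close>.  For \<open>\<parallel>X\<parallel> \<le> 1\<close> their increments are dominated by those of the scalar
  iteration with \<open>X = 1\<close>.\<close>

primrec sqrt_iter :: "('a::complex_inner \<Rightarrow> 'a) \<Rightarrow> nat \<Rightarrow> 'a \<Rightarrow> 'a" where
  "sqrt_iter X 0 = (\<lambda>x. 0)"
| "sqrt_iter X (Suc n) = (\<lambda>x. (1/2) *\<^sub>R (X x + sqrt_iter X n (sqrt_iter X n x)))"

primrec sqrt_iter_bound :: "nat \<Rightarrow> real" where
  "sqrt_iter_bound 0 = 0"
| "sqrt_iter_bound (Suc n) = (1 + (sqrt_iter_bound n)\<^sup>2) / 2"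

lemma sqrt_iter_bound_range: "0 \<le> sqrt_iter_bound n \<and> sqrt_iter_bound n \<le> 1"
  by (induction n) (auto simp: power_le_one)

lemma sqrt_iter_bound_mono: "sqrt_iter_bound n \<le> sqrt_iter_bound (Suc n)"
  using zero_le_power2[of "1 - sqrt_iter_bound n"] by (simp add: power2_diff)

lemma convergent_sqrt_iter_bound: "convergent sqrt_iter_bound"
proof (rule Bseq_monoseq_convergent)
  show "Bseq sqrt_iter_bound"
    by (rule BseqI'[where K = 1]) (use sqrt_iter_bound_range in auto)
  show "monoseq sqrt_iter_bound"
    using sqrt_iter_bound_mono by (simp add: monoseq_Suc del: sqrt_iter_bound.simps)
qed

lemma bounded_clinear_sqrt_iter:
  assumes "bounded_clinear X"
  shows "bounded_clinear (sqrt_iter X n)"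
proof (induction n)
  case (Suc n)
  then show ?case
    using bounded_clinear_compose[OF Suc Suc] assms
    by (auto intro!: bounded_clinear_scaleR_op bounded_clinear_add_op simp: o_def)
qed (simp add: bounded_clinear_const_zero)

lemma norm_sqrt_iter_le:
  assumes "\<And>x. norm (X x) \<le> norm x"
  shows "norm (sqrt_iter X n x) \<le> sqrt_iter_bound n * norm x"
proof (induction n arbitrary: x)
  case (Suc n)
  have "norm (sqrt_iter X n (sqrt_iter X n x)) \<le> sqrt_iter_bound n * norm (sqrt_iter X n x)"
    by (rule Suc)
  also have "\<dots> \<le> sqrt_iter_bound n * (sqrt_iter_bound n * norm x)"
    by (intro mult_left_mono Suc) (simp add: sqrt_iter_bound_range)
  finally have "norm (X x + sqrt_iter X n (sqrt_iter X n x)) \<le> (1 + (sqrt_iter_bound n)\<^sup>2) * norm x"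
    using assms[of x] norm_triangle_ineq[of "X x" "sqrt_iter X n (sqrt_iter X n x)"]
    by (simp add: algebra_simps power2_eq_square)
  then show ?case
    by simp
qed simp

text \<open>The splitting \<open>Z Z - Y Y = (Z - Y) Z + Y (Z - Y)\<close> holds without
  commutativity. With the scalar bounds it yields \<open>(k - m) k + m (k - m)\<close>, the
  difference of the squares, which is exactly twice the next scalar increment.\<close>

lemma norm_sqrt_iter_Suc_diff_le:
  assumes X: "bounded_clinear X" "\<And>x. norm (X x) \<le> norm x"
  shows "norm (sqrt_iter X (Suc n) x - sqrt_iter X n x)
    \<le> (sqrt_iter_bound (Suc n) - sqrt_iter_bound n) * norm x"
proof (induction n arbitrary: x)
  case 0
  show ?case using X(2)[of x] by simp
next
  case (Suc n)
  define Y Z where "Y = sqrt_iter X n" and "Z = sqrt_iter X (Suc n)"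
  define m k where "m = sqrt_iter_bound n" and "k = sqrt_iter_bound (Suc n)"
  have mk: "0 \<le> m" "m \<le> k"
    using sqrt_iter_bound_range sqrt_iter_bound_mono[of n] by (auto simp: m_def k_def)
  have IH: "norm (Z x - Y x) \<le> (k - m) * norm x" for x
    using Suc by (simp only: Y_def Z_def m_def k_def)
  have "norm (Z (Z x) - Y (Y x)) = norm ((Z (Z x) - Y (Z x)) + Y (Z x - Y x))"
    using bounded_clinear_sqrt_iter[OF X(1), of n] by (simp add: Y_def bounded_clinear_diff)
  also have "\<dots> \<le> norm (Z (Z x) - Y (Z x)) + norm (Y (Z x - Y x))"
    by (rule norm_triangle_ineq)
  also have "\<dots> \<le> (k - m) * norm (Z x) + m * norm (Z x - Y x)"
    using IH[of "Z x"] norm_sqrt_iter_le[OF X(2), where n = n] by (auto simp: Y_def m_def intro: add_mono)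
  also have "\<dots> \<le> (k - m) * (k * norm x) + m * ((k - m) * norm x)"
    using IH[of x] norm_sqrt_iter_le[OF X(2), of "Suc n" x] mk
    unfolding Z_def[symmetric] k_def[symmetric] by (intro add_mono mult_left_mono) auto
  also have "\<dots> = (k\<^sup>2 - m\<^sup>2) * norm x"
    by (simp add: power2_eq_square algebra_simps)
  finally have le: "norm (Z (Z x) - Y (Y x)) \<le> (k\<^sup>2 - m\<^sup>2) * norm x" .
  have Y: "sqrt_iter X (Suc (Suc n)) x - sqrt_iter X (Suc n) x = (1/2) *\<^sub>R (Z (Z x) - Y (Y x))"
    by (simp add: Y_def Z_def algebra_simps)
  have m: "sqrt_iter_bound (Suc (Suc n)) - sqrt_iter_bound (Suc n) = (k\<^sup>2 - m\<^sup>2) / 2"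
    by (simp add: k_def m_def field_simps)
  show ?case
    unfolding Y m using le by simp
qed

lemma norm_sqrt_iter_diff_le:
  assumes X: "bounded_clinear X" "\<And>x. norm (X x) \<le> norm x" and "n \<le> k"
  shows "norm (sqrt_iter X k x - sqrt_iter X n x)
    \<le> (sqrt_iter_bound k - sqrt_iter_bound n) * norm x"
  using \<open>n \<le> k\<close>
proof (induction k rule: dec_induct)
  case (step k)
  then show ?case
    using norm_sqrt_iter_Suc_diff_le[OF X, of k x]
      norm_triangle_ineq[of "sqrt_iter X (Suc k) x - sqrt_iter X k x" "sqrt_iter X k x - sqrt_iter X n x"]
    by (simp add: left_diff_distrib del: sqrt_iter.simps sqrt_iter_bound.simps)
qed simp

lemma sqrt_iter_convergent:
  fixes X :: "'a::chilbert_space \<Rightarrow> 'a"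
  assumes X: "bounded_clinear X" "\<And>x. norm (X x) \<le> norm x"
  shows "convergent (\<lambda>n. sqrt_iter X n x)"
proof -
  have "Cauchy (\<lambda>n. sqrt_iter X n x)"
  proof (rule CauchyI')
    fix e :: real assume "e > 0"
    \<comment> \<open>Adding 1 covers \<open>x = 0\<close> and makes the final estimate
      strict.\<close>
    then have "0 < e / (norm x + 1)"
      by (simp add: add_nonneg_pos)
    then obtain M where M: "\<And>k n. k \<ge> M \<Longrightarrow> n \<ge> M \<Longrightarrow>
        norm (sqrt_iter_bound k - sqrt_iter_bound n) < e / (norm x + 1)"
      using convergent_sqrt_iter_bound unfolding Cauchy_convergent_iff[symmetric] Cauchy_iff by blast
    have "dist (sqrt_iter X n x) (sqrt_iter X k x) < e" if "n \<ge> M" "n < k" for n k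
    proof -
      have "dist (sqrt_iter X n x) (sqrt_iter X k x) \<le> (sqrt_iter_bound k - sqrt_iter_bound n) * norm x"
        using norm_sqrt_iter_diff_le[OF X, of n k x] that by (simp add: dist_norm norm_minus_commute)
      also have "\<dots> \<le> e / (norm x + 1) * norm x"
        using M[of k n] that by (intro mult_right_mono) auto
      also have "\<dots> < e"
        using \<open>e > 0\<close> add_nonneg_pos[OF norm_ge_zero[of x] zero_less_one]
        by (simp add: field_simps)
      finally show ?thesis .
    qed
    then show "\<exists>M. \<forall>n\<ge>M. \<forall>k>n. dist (sqrt_iter X n x) (sqrt_iter X k x) < e"
      by blast
  qed
  then show ?thesis
    by (rule Cauchy_convergent)
qed

section \<open>Positive operators\<close>

lemma positive_opI:
  assumes "bounded_clinear P" "\<And>x y. P x \<bullet>\<^sub>C y = x \<bullet>\<^sub>C P y" "\<And>x. 0 \<le> Re (x \<bullet>\<^sub>C P x)"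
  shows "positive_op P"
  unfolding positive_op_def
proof (intro conjI allI assms(1,3))
  fix x
  have "cnj (x \<bullet>\<^sub>C P x) = x \<bullet>\<^sub>C P x"
    by (simp add: assms(2) flip: cinner_commute)
  then show "x \<bullet>\<^sub>C P x \<in> \<real>"
    by (metis Reals_cnj_iff)
qed

lemma positive_op_bounded_clinear: "positive_op P \<Longrightarrow> bounded_clinear P"
  by (simp add: positive_op_def)

text \<open>Polarization: the sesquilinear defect \<open>s\<close> vanishes on the diagonal.
  Expanding at \<open>x + y\<close> makes \<open>s\<close> antisymmetric, expanding at
  \<open>x + \<i> *\<^sub>C y\<close> makes it symmetric.\<close>

lemma positive_op_selfadjoint:
  assumes P: "positive_op P"
  shows "P x \<bullet>\<^sub>C y = x \<bullet>\<^sub>C P y"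
proof -
  note lin = positive_op_bounded_clinear[OF P]
  define s where "s u v = u \<bullet>\<^sub>C P v - P u \<bullet>\<^sub>C v" for u v
  have diag: "s u u = 0" for u
  proof -
    have "cnj (u \<bullet>\<^sub>C P u) = u \<bullet>\<^sub>C P u"
      using P by (metis positive_op_def Reals_cnj_iff)
    then show ?thesis
      by (simp add: s_def flip: cinner_commute)
  qed
  have "s (x + y) (x + y) = s x x + s y y + (s x y + s y x)"
    by (simp add: s_def bounded_clinear_add[OF lin] cinner_add_left cinner_add_right)
  then have 1: "s x y + s y x = 0"
    by (simp add: diag)
  have "s (x + \<i> *\<^sub>C y) (x + \<i> *\<^sub>C y) = s x x + s y y + \<i> * (s x y - s y x)"
    by (simp add: s_def bounded_clinear_add[OF lin] bounded_clinear_scaleC[OF lin] cinner_add_left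
        cinner_add_right cinner_scaleC_left cinner_scaleC_right algebra_simps)
  then have "s x y = s y x"
    by (simp add: diag)
  with 1 show ?thesis
    by (simp add: s_def)
qed

lemma positive_op_eq_0:
  assumes P: "positive_op P" and 0: "Re (y \<bullet>\<^sub>C P y) = 0"
  shows "P y = 0"
proof (rule ccontr)
  assume "P y \<noteq> 0"
  note lin = positive_op_bounded_clinear[OF P]
  define a c where "a = (norm (P y))\<^sup>2" and "c = Re (P y \<bullet>\<^sub>C P (P y))"
  have ac: "a > 0" "c \<ge> 0"
    using \<open>P y \<noteq> 0\<close> P by (auto simp: a_def c_def positive_op_def)
  \<comment> \<open>Along \<open>y + t *\<^sub>R P y\<close> the quadratic form is
    \<open>2 * t * a + t\<^sup>2 * c\<close>, and its linear term wins for small negative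
    \<open>t\<close>. This \<open>t\<close> makes the value at most \<open>t * a\<close>; the
    denominator is \<open>c + 1\<close> because \<open>c\<close> may vanish.\<close>
  define t where "t = - a / (c + 1)"
  have "P y \<bullet>\<^sub>C P y = complex_of_real a"
    by (simp add: a_def cinner_self)
  moreover from this have "y \<bullet>\<^sub>C P (P y) = complex_of_real a"
    by (simp add: positive_op_selfadjoint[OF P, symmetric])
  ultimately have "Re ((y + t *\<^sub>R P y) \<bullet>\<^sub>C P (y + t *\<^sub>R P y)) = 2 * t * a + t\<^sup>2 * c"
    using 0 by (simp add: bounded_clinear_add[OF lin] bounded_clinear_scaleR[OF lin] cinner_add_left
        cinner_add_right cinner_scaleR_left cinner_scaleR_right c_def algebra_simps power2_eq_square)
  moreover have "t * (c + 1) = - a" "t < 0"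
    using ac by (simp_all add: t_def divide_neg_pos)
  then have "t\<^sup>2 * c \<le> - (t * a)" "t * a < 0"
    using mult_left_mono[of c "c + 1" "t\<^sup>2"] ac(1) by (simp_all add: power2_eq_square mult_neg_pos mult.assoc)
  moreover have "Re ((y + t *\<^sub>R P y) \<bullet>\<^sub>C P (y + t *\<^sub>R P y)) \<ge> 0"
    using P by (simp add: positive_op_def)
  ultimately show False by linarith
qed

text \<open>The last hypothesis makes \<open>X = 1 - A\<close> a contraction, and the root is
  \<open>1 - Y\<close> for the pointwise limit \<open>Y\<close> of the iterates. Each iterate is a
  polynomial in \<open>X\<close>, which gives self-adjointness and the commutation clause in the
  limit; \<open>Y\<close> is again a contraction, which gives positivity of
  \<open>1 - Y\<close>.\<close>

lemma positive_sqrt_exists_near_id: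
  fixes A :: "'a::chilbert_space \<Rightarrow> 'a"
  assumes A: "bounded_clinear A" "\<And>x y. A x \<bullet>\<^sub>C y = x \<bullet>\<^sub>C A y" "\<And>x. norm (x - A x) \<le> norm x"
  shows "\<exists>P. positive_op P \<and> P \<circ> P = A \<and>
    (\<forall>C. bounded_clinear C \<longrightarrow> C \<circ> A = A \<circ> C \<longrightarrow> C \<circ> P = P \<circ> C)"
proof -
  define X where "X x = x - A x" for x
  have X: "bounded_clinear X" "\<And>x. norm (X x) \<le> norm x"
    unfolding X_def using A by (auto intro: bounded_clinear_diff_op bounded_clinear_id)
  define Y where "Y x = lim (\<lambda>n. sqrt_iter X n x)" for x
  have Y: "(\<lambda>n. sqrt_iter X n x) \<longlonglongrightarrow> Y x" for x
    unfolding Y_def using sqrt_iter_convergent[OF X] convergent_LIMSEQ_iff by blast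
  note lin = bounded_clinear_sqrt_iter[OF X(1)]
  have contr: "norm (sqrt_iter X n x) \<le> norm x" for n x
    using norm_sqrt_iter_le[OF X(2), of n x] sqrt_iter_bound_range[of n]
      mult_right_mono[of "sqrt_iter_bound n" 1 "norm x"] by simp
  have normY: "norm (Y x) \<le> norm x" for x
    by (rule tendsto_upperbound[OF tendsto_norm[OF Y]]) (simp_all add: contr)
  have linY: "bounded_clinear Y"
  proof (rule bounded_clinearI[where K = 1])
    show "Y (x + y) = Y x + Y y" for x y
      using LIMSEQ_unique[OF Y[of "x + y"]] tendsto_add[OF Y[of x] Y[of y]]
      by (simp add: bounded_clinear_add[OF lin])
    show "Y (c *\<^sub>C x) = c *\<^sub>C Y x" for c x
    proof (rule LIMSEQ_unique[OF Y])
      show "(\<lambda>n. sqrt_iter X n (c *\<^sub>C x)) \<longlonglongrightarrow> c *\<^sub>C Y x"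
        unfolding bounded_clinear_scaleC[OF lin]
        by (rule bounded_clinear_tendsto[OF bounded_clinear_scaleC_op Y])
    qed
  qed (simp add: normY)
  \<comment> \<open>Convergence is only pointwise, so products need an argument: shift the inner
    iterate to \<open>Y x\<close>, the error being harmless because all iterates are
    contractions.\<close>
  have YY: "(\<lambda>n. sqrt_iter X n (sqrt_iter X n x)) \<longlonglongrightarrow> Y (Y x)" for x
  proof -
    have "(\<lambda>n. sqrt_iter X n (sqrt_iter X n x - Y x)) \<longlonglongrightarrow> 0"
    proof (rule Lim_null_comparison)
      show "(\<lambda>n. norm (sqrt_iter X n x - Y x)) \<longlonglongrightarrow> 0"
        using Y[of x] by (simp add: LIM_zero_iff tendsto_norm_zero_iff)
    qed (simp add: contr)
    from tendsto_add[OF this Y[of "Y x"]] show ?thesis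
      by (simp add: bounded_clinear_diff[OF lin])
  qed
  have fix_Y: "2 *\<^sub>R Y x = X x + Y (Y x)" for x
  proof -
    have "(\<lambda>n. sqrt_iter X (Suc n) x) \<longlonglongrightarrow> (1/2) *\<^sub>R (X x + Y (Y x))"
      unfolding sqrt_iter.simps by (intro tendsto_intros YY)
    then have "Y x = (1/2) *\<^sub>R (X x + Y (Y x))"
      using LIMSEQ_unique LIMSEQ_Suc[OF Y[of x]] by blast
    then show ?thesis
      by (metis field_sum_of_halves scaleR_half_double scaleR_2 scaleR_scaleR mult_1 scaleR_one
          nonzero_mult_div_cancel_left times_divide_eq_right zero_neq_numeral mult.right_neutral)
  qed
  have self_iter: "sqrt_iter X n x \<bullet>\<^sub>C y = x \<bullet>\<^sub>C sqrt_iter X n y" for n x y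
    by (induction n arbitrary: x y)
      (simp_all add: X_def A(2) cinner_add_left cinner_add_right cinner_diff_left cinner_diff_right
        cinner_scaleR_left cinner_scaleR_right)
  have selfY: "Y x \<bullet>\<^sub>C y = x \<bullet>\<^sub>C Y y" for x y
    using LIMSEQ_unique[OF tendsto_cinner_left[OF Y[of x], of y]]
      tendsto_cinner_right[OF Y[of y], of x] by (simp add: self_iter)
  have commY: "C (Y x) = Y (C x)" if C: "bounded_clinear C" "C \<circ> A = A \<circ> C" for C x
  proof -
    have CA: "C (A x) = A (C x)" for x
      using C(2) by (simp add: fun_eq_iff)
    have "C (sqrt_iter X n x) = sqrt_iter X n (C x)" for n x
      by (induction n arbitrary: x)
        (simp_all add: X_def CA bounded_clinear_zero[OF C(1)] bounded_clinear_add[OF C(1)]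
          bounded_clinear_diff[OF C(1)] bounded_clinear_scaleR[OF C(1)])
    then show ?thesis
      using LIMSEQ_unique[OF bounded_clinear_tendsto[OF C(1) Y[of x]]] Y[of "C x"] by simp
  qed
  define P where "P x = x - Y x" for x
  have "positive_op P"
  proof (rule positive_opI)
    show "bounded_clinear P"
      unfolding P_def by (intro bounded_clinear_diff_op bounded_clinear_id linY)
    show "P x \<bullet>\<^sub>C y = x \<bullet>\<^sub>C P y" for x y
      by (simp add: P_def cinner_diff_left cinner_diff_right selfY)
    show "0 \<le> Re (x \<bullet>\<^sub>C P x)" for x
    proof -
      have "Re (x \<bullet>\<^sub>C Y x) \<le> norm x * norm (Y x)"
        using complex_Re_le_cmod cmod_cinner_le order_trans by blast
      also have "\<dots> \<le> (norm x)\<^sup>2"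
        using normY[of x] by (simp add: power2_eq_square mult_left_mono)
      finally show ?thesis
        by (simp add: P_def cinner_diff_right cinner_self)
    qed
  qed
  moreover have "P \<circ> P = A"
  proof
    fix x
    have "P (P x) = x - (2 *\<^sub>R Y x - Y (Y x))"
      by (simp add: P_def bounded_clinear_diff[OF linY] scaleR_2)
    then show "(P \<circ> P) x = A x"
      by (simp add: fix_Y X_def)
  qed
  moreover have "C \<circ> P = P \<circ> C" if "bounded_clinear C" "C \<circ> A = A \<circ> C" for C
    using commY[OF that] by (simp add: fun_eq_iff P_def bounded_clinear_diff[OF that(1)])
  ultimately show ?thesis by blast
qed

lemma positive_sqrt_exists:
  fixes T :: "'a::chilbert_space \<Rightarrow> 'a"
  assumes T: "bounded_clinear T"
  shows "\<exists>P. positive_op P \<and> P \<circ> P = adj T \<circ> T \<and>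
    (\<forall>C. bounded_clinear C \<longrightarrow> C \<circ> (adj T \<circ> T) = (adj T \<circ> T) \<circ> C \<longrightarrow> C \<circ> P = P \<circ> C)"
proof -
  obtain K where K: "K > 0" "\<And>x. norm (T x) \<le> norm x * K"
    by (rule bounded_clinear_bound[OF T]) blast
  \<comment> \<open>Dividing by the square of a norm bound for \<open>T\<close> brings the operator
    into the range of the iteration; the root is scaled back by \<open>K\<close>.\<close>
  define A where "A x = (1 / K\<^sup>2) *\<^sub>R adj T (T x)" for x
  have linA: "bounded_clinear A"
    unfolding A_def
    using bounded_clinear_compose[OF bounded_clinear_adj[OF T] T]
    by (intro bounded_clinear_scaleR_op) (simp add: o_def)
  have norm_adj: "norm (adj T y) \<le> norm y * K" for y
    by (rule norm_adjoint_le[OF K]) (simp add: cinner_adj_right[OF T])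
  have "norm (x - A x) \<le> norm x" for x
  proof -
    have 1: "inner x (A x) = (norm (T x))\<^sup>2 / K\<^sup>2"
      by (simp add: A_def inner_eq_Re_cinner cinner_scaleR_right cinner_adj_right[OF T] cinner_self)
    have "norm (A x) = norm (adj T (T x)) / K\<^sup>2"
      using K(1) by (simp add: A_def)
    also have "\<dots> \<le> norm (T x) / K"
      using norm_adj[of "T x"] K(1) by (simp add: field_simps power2_eq_square)
    finally have "(norm (A x))\<^sup>2 \<le> (norm (T x) / K)\<^sup>2"
      by (intro power_mono) auto
    \<comment> \<open>The cross term is twice the square of \<open>norm (T x) / K\<close>, and the
      last term is at most that square once, so the sum cannot exceed the square of
      \<open>norm x\<close>.\<close>
    moreover have "(norm (x - A x))\<^sup>2 = (norm x)\<^sup>2 - 2 * inner x (A x) + (norm (A x))\<^sup>2"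
      by (simp add: power2_norm_eq_inner inner_diff_left inner_diff_right inner_commute)
    ultimately have "(norm (x - A x))\<^sup>2 \<le> (norm x)\<^sup>2"
      using zero_le_power2[of "norm (T x) / K"] unfolding 1 power_divide by linarith
    then show ?thesis
      by (rule power2_le_imp_le) simp
  qed
  moreover have "A x \<bullet>\<^sub>C y = x \<bullet>\<^sub>C A y" for x y
    by (simp add: A_def cinner_scaleR_left cinner_scaleR_right cinner_adj_right[OF T] cinner_adj_left[OF T])
  ultimately obtain Q where Q: "positive_op Q" "Q \<circ> Q = A"
      "\<And>C. bounded_clinear C \<Longrightarrow> C \<circ> A = A \<circ> C \<Longrightarrow> C \<circ> Q = Q \<circ> C"
    using positive_sqrt_exists_near_id[OF linA] by blast
  note linQ = positive_op_bounded_clinear[OF Q(1)]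
  define P where "P x = K *\<^sub>R Q x" for x
  have "bounded_clinear P"
    unfolding P_def by (rule bounded_clinear_scaleR_op[OF linQ])
  then have "positive_op P"
    using Q(1) K(1) positive_op_selfadjoint[OF Q(1)]
    by (intro positive_opI)
      (simp_all add: P_def cinner_scaleR_left cinner_scaleR_right positive_op_def)
  moreover have "P \<circ> P = adj T \<circ> T"
  proof
    fix x
    have "P (P x) = (K * K) *\<^sub>R (Q \<circ> Q) x"
      by (simp add: P_def bounded_clinear_scaleR[OF linQ])
    then show "(P \<circ> P) x = (adj T \<circ> T) x"
      unfolding Q(2) using K(1) by (simp add: A_def power2_eq_square)
  qed
  moreover have "C \<circ> P = P \<circ> C"
    if C: "bounded_clinear C" "C \<circ> (adj T \<circ> T) = (adj T \<circ> T) \<circ> C" for C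
  proof -
    have "C \<circ> A = A \<circ> C"
      using C(2) by (simp add: fun_eq_iff A_def bounded_clinear_scaleR[OF C(1)])
    from Q(3)[OF C(1) this] show ?thesis
      by (simp add: fun_eq_iff P_def bounded_clinear_scaleR[OF C(1)])
  qed
  ultimately show ?thesis by blast
qed

text \<open>Commutation gives \<open>(P + Q) (P - Q) = 0\<close>. For \<open>y = (P - Q) x\<close>
  the two nonnegative forms of \<open>P\<close> and \<open>Q\<close> at \<open>y\<close> thus add up
  to zero, so both operators annihilate \<open>y\<close>, and moving \<open>P - Q\<close> across the
  inner product shows that \<open>y\<close> has norm zero.\<close>

lemma commuting_positive_sqrt_unique:
  assumes P: "positive_op P" and Q: "positive_op Q"
    and sq: "P \<circ> P = Q \<circ> Q" and comm: "P \<circ> Q = Q \<circ> P"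
  shows "P = Q"
proof
  fix x
  note linP = positive_op_bounded_clinear[OF P] and linQ = positive_op_bounded_clinear[OF Q]
  define y where "y = P x - Q x"
  have eqs: "P (P x) = Q (Q x)" "P (Q x) = Q (P x)"
    using sq comm by (simp_all add: fun_eq_iff)
  have "P y + Q y = 0"
    by (simp add: y_def bounded_clinear_diff[OF linP] bounded_clinear_diff[OF linQ] eqs)
  then have "Re (y \<bullet>\<^sub>C P y) + Re (y \<bullet>\<^sub>C Q y) = 0"
    by (simp flip: cinner_add_right plus_complex.sel)
  moreover have "Re (y \<bullet>\<^sub>C P y) \<ge> 0" "Re (y \<bullet>\<^sub>C Q y) \<ge> 0"
    using P Q by (simp_all add: positive_op_def)
  ultimately have "Re (y \<bullet>\<^sub>C P y) = 0" "Re (y \<bullet>\<^sub>C Q y) = 0"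
    by linarith+
  then have "P y = 0" "Q y = 0"
    using positive_op_eq_0 P Q by blast+
  have "y \<bullet>\<^sub>C y = x \<bullet>\<^sub>C P y - x \<bullet>\<^sub>C Q y"
    by (subst y_def)
      (simp add: cinner_diff_left positive_op_selfadjoint[OF P] positive_op_selfadjoint[OF Q])
  then have "y \<bullet>\<^sub>C y = 0"
    by (simp add: \<open>P y = 0\<close> \<open>Q y = 0\<close>)
  then show "P x = Q x"
    using cinner_self_eq_0[of y] by (simp add: y_def)
qed

lemma abs_op_characterization:
  assumes T: "bounded_clinear T"
  shows positive_op_abs_op: "positive_op (abs_op T)"
    and abs_op_square: "abs_op T \<circ> abs_op T = adj T \<circ> T"
    and abs_op_unique: "positive_op Q \<Longrightarrow> Q \<circ> Q = adj T \<circ> T \<Longrightarrow> abs_op T = Q"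
proof -
  obtain P where P: "positive_op P" "P \<circ> P = adj T \<circ> T"
      "\<And>C. bounded_clinear C \<Longrightarrow> C \<circ> (adj T \<circ> T) = (adj T \<circ> T) \<circ> C \<Longrightarrow> C \<circ> P = P \<circ> C"
    using positive_sqrt_exists[OF T] by blast
  have uniq: "Q = P" if Q: "positive_op Q" "Q \<circ> Q = adj T \<circ> T" for Q
  proof (rule commuting_positive_sqrt_unique[OF Q(1) P(1)])
    show "Q \<circ> P = P \<circ> Q"
    proof (rule P(3))
      show "bounded_clinear Q"
        by (rule positive_op_bounded_clinear[OF Q(1)])
      show "Q \<circ> (adj T \<circ> T) = (adj T \<circ> T) \<circ> Q"
        unfolding Q(2)[symmetric] by (rule o_assoc)
    qed
  qed (simp only: P(2) Q(2))
  have "abs_op T = P"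
    unfolding abs_op_def sqrt_op_def by (rule the_equality) (simp_all only: P(1,2) uniq simp_thms)
  with P(1,2) show "positive_op (abs_op T)" "abs_op T \<circ> abs_op T = adj T \<circ> T"
    by (simp_all only:)
  show "abs_op T = Q" if "positive_op Q" "Q \<circ> Q = adj T \<circ> T"
    using uniq[OF that] \<open>abs_op T = P\<close> by (simp only:)
qed


section \<open>Polar decomposition\<close>

text \<open>Minimizing sequences for the distance from \<open>x\<close> to \<open>M\<close> are
  Cauchy. Since \<open>M\<close> need not be closed, the nearest point is found in its
  closure.\<close>

lemma orthogonal_projection_exists:
  fixes M :: "'a::{real_inner, complete_space} set"
  assumes M: "subspace M"
  shows "\<exists>p\<in>closure M. \<forall>m\<in>M. inner (x - p) m = 0"
proof -
  define d where "d = (INF m\<in>M. (norm (x - m))\<^sup>2)"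
  have bdd: "bdd_below ((\<lambda>m. (norm (x - m))\<^sup>2) ` M)"
    by (rule bdd_belowI2[where m = 0]) simp
  have d_le: "d \<le> (norm (x - m))\<^sup>2" if "m \<in> M" for m
    unfolding d_def by (rule cINF_lower[OF bdd that])
  have "\<exists>m\<in>M. (norm (x - m))\<^sup>2 < d + inverse (real (Suc n))" for n
  proof (rule ccontr)
    assume "\<not> ?thesis"
    then have "d + inverse (real (Suc n)) \<le> d"
      unfolding d_def using subspace_0[OF M] by (intro cINF_greatest) (auto simp: not_less)
    then show False by simp
  qed
  then obtain f where f: "\<And>n. f n \<in> M" "\<And>n. (norm (x - f n))\<^sup>2 < d + inverse (real (Suc n))"
    by metis
  have close: "(norm (f i - f j))\<^sup>2 \<le> 2 * inverse (real (Suc i)) + 2 * inverse (real (Suc j))" for i j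
  proof -
    have "(1/2) *\<^sub>R (f i + f j) \<in> M"
      using f(1) M by (simp add: subspace_add subspace_scale)
    from d_le[OF this] have "4 * d \<le> (2 * norm (x - (1/2) *\<^sub>R (f i + f j)))\<^sup>2"
      by (simp add: power_mult_distrib)
    also have "2 * norm (x - (1/2) *\<^sub>R (f i + f j)) = norm (2 *\<^sub>R (x - (1/2) *\<^sub>R (f i + f j)))"
      by simp
    also have "2 *\<^sub>R (x - (1/2) *\<^sub>R (f i + f j)) = (x - f i) + (x - f j)"
      by (simp add: scaleR_2 scaleR_diff_right)
    finally have "4 * d \<le> (norm ((x - f i) + (x - f j)))\<^sup>2" .
    \<comment> \<open>Parallelogram law for \<open>x - f i\<close> and \<open>x - f j\<close>; the
      midpoint of \<open>f i\<close> and \<open>f j\<close> lies in \<open>M\<close>, so the norm of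
      their sum is bounded below through \<open>d\<close>.\<close>
    moreover have "(norm (f i - f j))\<^sup>2 + (norm ((x - f i) + (x - f j)))\<^sup>2
        = 2 * (norm (x - f i))\<^sup>2 + 2 * (norm (x - f j))\<^sup>2"
      by (simp add: power2_norm_eq_inner inner_add_left inner_add_right inner_diff_left
          inner_diff_right inner_commute)
    ultimately show ?thesis
      using f(2)[of i] f(2)[of j] by linarith
  qed
  have "Cauchy f"
  proof (rule CauchyI)
    fix e :: real assume "e > 0"
    then have "e\<^sup>2 / 4 > 0" by simp
    then obtain N where N: "inverse (real (Suc N)) < e\<^sup>2 / 4"
      using reals_Archimedean by blast
    have "norm (f i - f j) < e" if "i \<ge> N" "j \<ge> N" for i j
    proof -
      have "inverse (real (Suc i)) \<le> inverse (real (Suc N))" "inverse (real (Suc j)) \<le> inverse (real (Suc N))"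
        using that by (simp_all add: le_imp_inverse_le)
      with close[of i j] N have "(norm (f i - f j))\<^sup>2 < e\<^sup>2"
        by linarith
      then show ?thesis
        using \<open>e > 0\<close> by (intro power_less_imp_less_base[of _ 2 e]) auto
    qed
    then show "\<exists>N. \<forall>i\<ge>N. \<forall>j\<ge>N. norm (f i - f j) < e" by blast
  qed
  then obtain p where p: "f \<longlonglongrightarrow> p"
    using Cauchy_convergent convergent_def by blast
  have "(norm (x - p))\<^sup>2 \<le> d"
  proof (rule LIMSEQ_le)
    show "(\<lambda>n. (norm (x - f n))\<^sup>2) \<longlonglongrightarrow> (norm (x - p))\<^sup>2"
      by (intro tendsto_intros p)
    show "(\<lambda>n. d + inverse (real (Suc n))) \<longlonglongrightarrow> d"
      using tendsto_add[OF tendsto_const[of d] LIMSEQ_inverse_real_of_nat] by simp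
    show "\<exists>N. \<forall>n\<ge>N. (norm (x - f n))\<^sup>2 \<le> d + inverse (real (Suc n))"
      using f(2) less_imp_le by blast
  qed
  have "inner (x - p) m = 0" if "m \<in> M" for m
  proof (cases "m = 0")
    case False
    \<comment> \<open>The minimizer of the distance from \<open>x\<close> along the line through
      \<open>p\<close> in direction \<open>m\<close>; a nonzero inner product would push the
      distance below \<open>d\<close>.\<close>
    define t where "t = inner (x - p) m / (norm m)\<^sup>2"
    have "d \<le> (norm (x - (p + t *\<^sub>R m)))\<^sup>2"
    proof (rule LIMSEQ_le_const)
      show "(\<lambda>n. (norm (x - (f n + t *\<^sub>R m)))\<^sup>2) \<longlonglongrightarrow> (norm (x - (p + t *\<^sub>R m)))\<^sup>2"
        by (intro tendsto_intros p)
      show "\<exists>N. \<forall>n\<ge>N. d \<le> (norm (x - (f n + t *\<^sub>R m)))\<^sup>2"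
        using d_le f(1) that M by (blast intro: subspace_add subspace_scale)
    qed
    also have "\<dots> = (norm (x - p))\<^sup>2 - 2 * t * inner (x - p) m + t\<^sup>2 * (norm m)\<^sup>2"
      unfolding diff_add_eq_diff_diff_swap[of x] power2_norm_eq_inner
      by (simp add: inner_add_left inner_add_right inner_diff_left inner_diff_right inner_commute
          power2_eq_square algebra_simps)
    also have "\<dots> = (norm (x - p))\<^sup>2 - (inner (x - p) m)\<^sup>2 / (norm m)\<^sup>2"
      using False by (simp add: t_def power2_eq_square)
    finally have "(inner (x - p) m)\<^sup>2 / (norm m)\<^sup>2 \<le> 0"
      using \<open>(norm (x - p))\<^sup>2 \<le> d\<close> by linarith
    then show ?thesis
      using False by (simp add: divide_le_0_iff)
  qed simp
  moreover have "p \<in> closure M"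
    unfolding closure_sequential using f(1) p by blast
  ultimately show ?thesis by blast
qed

section \<open>The graph of the polar factor\<close>

lemma norm_abs_op:
  assumes T: "bounded_clinear T"
  shows "norm (abs_op T x) = norm (T x)"
proof -
  have "abs_op T x \<bullet>\<^sub>C abs_op T x = x \<bullet>\<^sub>C (abs_op T \<circ> abs_op T) x"
    by (simp add: positive_op_selfadjoint[OF positive_op_abs_op[OF T]])
  also have "\<dots> = T x \<bullet>\<^sub>C T x"
    by (simp add: abs_op_square[OF T] cinner_adj_right[OF T])
  finally have "(norm (abs_op T x))\<^sup>2 = (norm (T x))\<^sup>2"
    unfolding cinner_self using of_real_eq_iff by blast
  then show ?thesis
    by (simp add: power2_eq_iff_nonneg)
qed

text \<open>\<open>p\<close> is the projection of \<open>x\<close> to the closure of the range of \<open>|T|\<close>, and \<open>y\<close> is the image of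
  \<open>p\<close> under the isometric extension of \<open>|T| z \<mapsto> T z\<close>; that is, \<open>y = U x\<close> in the polar
  decomposition.\<close>

definition polar_rel :: "('a::chilbert_space \<Rightarrow> 'a) \<Rightarrow> 'a \<Rightarrow> 'a \<Rightarrow> 'a \<Rightarrow> bool" where
  "polar_rel T x p y \<longleftrightarrow> (\<forall>w. (x - p) \<bullet>\<^sub>C abs_op T w = 0) \<and>
    (\<exists>z. (\<lambda>n. abs_op T (z n)) \<longlonglongrightarrow> p \<and> (\<lambda>n. T (z n)) \<longlonglongrightarrow> y)"

context
  fixes T :: "'a::chilbert_space \<Rightarrow> 'a"
  assumes T: "bounded_clinear T"
begin

lemma bounded_clinear_abs_op: "bounded_clinear (abs_op T)"
  by (rule positive_op_bounded_clinear[OF positive_op_abs_op[OF T]])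

lemma polar_rel_add:
  assumes "polar_rel T x p y" "polar_rel T x' p' y'"
  shows "polar_rel T (x + x') (p + p') (y + y')"
proof -
  obtain z z' where z: "(\<lambda>n. abs_op T (z n)) \<longlonglongrightarrow> p" "(\<lambda>n. T (z n)) \<longlonglongrightarrow> y"
      "(\<lambda>n. abs_op T (z' n)) \<longlonglongrightarrow> p'" "(\<lambda>n. T (z' n)) \<longlonglongrightarrow> y'"
    using assms unfolding polar_rel_def by blast
  have "((x + x') - (p + p')) \<bullet>\<^sub>C abs_op T w = 0" for w
  proof -
    have "((x - p) + (x' - p')) \<bullet>\<^sub>C abs_op T w = 0"
      unfolding cinner_add_left using assms by (simp add: polar_rel_def)
    then show ?thesis
      by (simp add: algebra_simps)
  qed
  moreover have "(\<lambda>n. abs_op T (z n + z' n)) \<longlonglongrightarrow> p + p'" "(\<lambda>n. T (z n + z' n)) \<longlonglongrightarrow> y + y'"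
    unfolding bounded_clinear_add[OF bounded_clinear_abs_op] bounded_clinear_add[OF T]
    by (intro tendsto_add z)+
  ultimately show ?thesis
    unfolding polar_rel_def by (intro conjI exI[of _ "\<lambda>n. z n + z' n"]) blast+
qed

lemma polar_rel_scaleC:
  assumes "polar_rel T x p y"
  shows "polar_rel T (c *\<^sub>C x) (c *\<^sub>C p) (c *\<^sub>C y)"
proof -
  obtain z where z: "(\<lambda>n. abs_op T (z n)) \<longlonglongrightarrow> p" "(\<lambda>n. T (z n)) \<longlonglongrightarrow> y"
    using assms unfolding polar_rel_def by blast
  have "(\<lambda>n. abs_op T (c *\<^sub>C z n)) \<longlonglongrightarrow> c *\<^sub>C p" "(\<lambda>n. T (c *\<^sub>C z n)) \<longlonglongrightarrow> c *\<^sub>C y"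
    unfolding bounded_clinear_scaleC[OF bounded_clinear_abs_op] bounded_clinear_scaleC[OF T]
    by (intro bounded_clinear_tendsto[OF bounded_clinear_scaleC_op] z)+
  moreover have "(c *\<^sub>C x - c *\<^sub>C p) \<bullet>\<^sub>C abs_op T w = 0" for w
    using assms by (simp add: cinner_scaleC_left polar_rel_def flip: scaleC_diff_right)
  ultimately show ?thesis
    unfolding polar_rel_def by (intro conjI exI[of _ "\<lambda>n. c *\<^sub>C z n"]) blast+
qed

lemma polar_rel_norm:
  assumes "polar_rel T x p y"
  shows polar_rel_norm_eq: "norm y = norm p"
    and polar_rel_orthogonal: "(x - p) \<bullet>\<^sub>C p = 0"
    and polar_rel_norm_le: "norm p \<le> norm x"
proof -
  obtain z where z: "(\<lambda>n. abs_op T (z n)) \<longlonglongrightarrow> p" "(\<lambda>n. T (z n)) \<longlonglongrightarrow> y"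
    using assms unfolding polar_rel_def by blast
  show "norm y = norm p"
    using LIMSEQ_unique[OF tendsto_norm[OF z(1)]] tendsto_norm[OF z(2)]
    by (simp add: norm_abs_op[OF T])
  have "(\<lambda>n. (x - p) \<bullet>\<^sub>C abs_op T (z n)) \<longlonglongrightarrow> (x - p) \<bullet>\<^sub>C p"
    by (rule tendsto_cinner_right[OF z(1)])
  then show orth: "(x - p) \<bullet>\<^sub>C p = 0"
    using assms LIMSEQ_unique tendsto_const[of 0] by (simp add: polar_rel_def LIMSEQ_const_iff)
  have "inner (x - p) p = 0"
    by (simp add: inner_eq_Re_cinner orth)
  then have "(norm x)\<^sup>2 = (norm p)\<^sup>2 + (norm (x - p))\<^sup>2"
    by (simp add: power2_norm_eq_inner inner_diff_left inner_diff_right inner_commute)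
  then show "norm p \<le> norm x"
    by (intro power2_le_imp_le[of "norm p"]) auto
qed

text \<open>The relation is linear, so the difference of two solutions is a solution for
  \<open>x = 0\<close>, and the norm estimates force that one to vanish.\<close>

lemma polar_rel_unique:
  assumes "polar_rel T x p y" "polar_rel T x p' y'"
  shows "p' = p \<and> y' = y"
proof -
  have "polar_rel T (x + (-1) *\<^sub>C x) (p' + (-1) *\<^sub>C p) (y' + (-1) *\<^sub>C y)"
    by (intro polar_rel_add polar_rel_scaleC assms)
  then have "polar_rel T 0 (p' - p) (y' - y)"
    by (simp add: scaleC_minus_one)
  from polar_rel_norm_le[OF this] polar_rel_norm_eq[OF this] show ?thesis
    by simp
qed

lemma polar_rel_total: "\<exists>p y. polar_rel T x p y"
proof -
  let ?P = "abs_op T"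
  have "subspace (range ?P)"
    by (rule linear_subspace_image[OF bounded_clinear_linear[OF bounded_clinear_abs_op] subspace_UNIV])
  then obtain p where p: "p \<in> closure (range ?P)" "\<And>w. inner (x - p) (?P w) = 0"
    using orthogonal_projection_exists[of "range ?P" x] by blast
  \<comment> \<open>The projection is orthogonal for the real inner product; testing with
    \<open>w\<close> and with \<open>\<i> *\<^sub>C w\<close> recovers the real and the imaginary
    part.\<close>
  have orth: "(x - p) \<bullet>\<^sub>C ?P w = 0" for w
  proof -
    have "Re ((x - p) \<bullet>\<^sub>C ?P (c *\<^sub>C w)) = 0" for c
      using p(2)[of "c *\<^sub>C w"] by (simp add: inner_eq_Re_cinner)
    from this[of 1] this[of \<i>] show ?thesis
      by (simp add: bounded_clinear_scaleC[OF bounded_clinear_abs_op] cinner_scaleC_right complex_eq_iff)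
  qed
  obtain f where f: "\<And>n. f n \<in> range ?P" "f \<longlonglongrightarrow> p"
    using p(1) unfolding closure_sequential by blast
  define z where "z n = inv ?P (f n)" for n
  have "?P (z n) = f n" for n
    unfolding z_def by (rule f_inv_into_f[OF f(1)])
  then have z: "(\<lambda>n. ?P (z n)) \<longlonglongrightarrow> p"
    using f(2) by (simp only:)
  \<comment> \<open>The preimages \<open>z n\<close> need not converge, but \<open>T\<close> and
    \<open>abs_op T\<close> have equal norms on their differences, so the images under
    \<open>T\<close> are Cauchy.\<close>
  have "norm (T (z i) - T (z j)) = norm (?P (z i) - ?P (z j))" for i j
    using norm_abs_op[OF T, of "z i - z j"]
    by (simp add: bounded_clinear_diff[OF T] bounded_clinear_diff[OF bounded_clinear_abs_op])
  then have "Cauchy (\<lambda>n. T (z n))"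
    using LIMSEQ_imp_Cauchy[OF z] by (simp add: Cauchy_iff)
  then obtain y where "(\<lambda>n. T (z n)) \<longlonglongrightarrow> y"
    using Cauchy_convergent convergent_def by blast
  with z orth show ?thesis
    unfolding polar_rel_def by blast
qed

lemma abs_op_eq_0_iff: "abs_op T x = 0 \<longleftrightarrow> T x = 0"
  using norm_abs_op[OF T, of x] by (metis norm_eq_zero)

text \<open>The orthogonal complement of the range of a self-adjoint operator is its kernel. Hence
  the part \<open>x - p\<close> split off by the projection lies in the kernel of
  \<open>T\<close>.\<close>

lemma orthogonal_range_abs_op_iff: "(\<forall>w. x \<bullet>\<^sub>C abs_op T w = 0) \<longleftrightarrow> T x = 0"
proof -
  have "(\<forall>w. x \<bullet>\<^sub>C abs_op T w = 0) \<longleftrightarrow> (\<forall>w. abs_op T x \<bullet>\<^sub>C w = 0)"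
    by (simp add: positive_op_selfadjoint[OF positive_op_abs_op[OF T]])
  also have "\<dots> \<longleftrightarrow> abs_op T x = 0"
    using cinner_self_eq_0 by auto
  finally show ?thesis
    by (simp add: abs_op_eq_0_iff)
qed

lemma polar_rel_kernel: "T x = 0 \<Longrightarrow> polar_rel T x 0 0"
  unfolding polar_rel_def
  using orthogonal_range_abs_op_iff[of x]
  by (auto intro!: exI[of _ "\<lambda>n. 0"]
      simp: bounded_clinear_zero[OF T] bounded_clinear_zero[OF bounded_clinear_abs_op])

lemma polar_rel_abs_op: "polar_rel T (abs_op T x) (abs_op T x) (T x)"
  unfolding polar_rel_def by (auto intro!: exI[of _ "\<lambda>n. x"])

lemma polar_rel_diff_kernel: "polar_rel T x p y \<Longrightarrow> T (x - p) = 0"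
  using orthogonal_range_abs_op_iff[of "x - p"] by (simp add: polar_rel_def)

lemma polar_decomposition_exists:
  "\<exists>U. partial_isometry U \<and> ker U = ker T \<and> T = U \<circ> abs_op T"
proof -
  obtain Q U where QU: "\<And>x. polar_rel T x (Q x) (U x)"
    using polar_rel_total by metis
  have U_eq: "U x = y" "Q x = p" if "polar_rel T x p y" for x p y
    using polar_rel_unique[OF that QU] by simp_all
  have norm_U: "norm (U x) = norm (Q x)" for x
    by (rule polar_rel_norm_eq[OF QU])
  have "bounded_clinear U"
  proof (rule bounded_clinearI[where K = 1])
    show "norm (U x) \<le> norm x * 1" for x
      using polar_rel_norm_le[OF QU, of x] by (simp add: norm_U)
  qed (rule U_eq[OF polar_rel_add[OF QU QU]] U_eq[OF polar_rel_scaleC[OF QU]])+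
  moreover have "norm (U x) = norm x" if "x \<in> orth_compl (ker U)" for x
  proof -
    \<comment> \<open>The residue \<open>x - Q x\<close> lies in \<open>ker U\<close>, so it is
      orthogonal to \<open>x\<close>; it is also orthogonal to \<open>Q x\<close>, hence to itself,
      and therefore \<open>Q x = x\<close>.\<close>
    have "U (x - Q x) = 0"
      by (rule U_eq[OF polar_rel_kernel[OF polar_rel_diff_kernel[OF QU]]])
    then have "x \<bullet>\<^sub>C (x - Q x) = 0"
      using that by (simp add: orth_compl_def ker_def)
    moreover have "Q x \<bullet>\<^sub>C (x - Q x) = 0"
      using polar_rel_orthogonal[OF QU, of x] cinner_commute[of "Q x" "x - Q x"] by simp
    ultimately have "(x - Q x) \<bullet>\<^sub>C (x - Q x) = 0"
      by (subst cinner_diff_left) simp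
    then show ?thesis
      using cinner_self_eq_0[of "x - Q x"] by (simp add: norm_U)
  qed
  moreover have "U x = 0 \<longleftrightarrow> T x = 0" for x
  proof
    assume "U x = 0"
    then have "Q x = 0"
      using norm_U[of x] by simp
    then show "T x = 0"
      using polar_rel_diff_kernel[OF QU, of x] by simp
  qed (rule U_eq[OF polar_rel_kernel])
  moreover have "T = U \<circ> abs_op T"
    using U_eq[OF polar_rel_abs_op] by (simp add: fun_eq_iff)
  ultimately show ?thesis
    unfolding partial_isometry_def ker_def by blast
qed

text \<open>Every candidate is forced: it kills \<open>x - p\<close> by the kernel condition, agrees
  with \<open>z \<mapsto> T z\<close> on the vectors \<open>abs_op T z\<close>, and is continuous,
  which fixes its value at \<open>p\<close>.\<close>

lemma polar_decomposition_eq: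
  assumes U: "bounded_clinear U" "ker U = ker T" "T = U \<circ> abs_op T" and "polar_rel T x p y"
  shows "U x = y"
proof -
  obtain z where z: "(\<lambda>n. abs_op T (z n)) \<longlonglongrightarrow> p" "(\<lambda>n. T (z n)) \<longlonglongrightarrow> y"
    using assms(4) unfolding polar_rel_def by blast
  have "U (x - p) = 0"
    using polar_rel_diff_kernel[OF assms(4)] U(2) by (auto simp: ker_def)
  then have "U x = U p"
    by (simp add: bounded_clinear_diff[OF U(1)])
  have "U (abs_op T w) = T w" for w
    using fun_cong[OF U(3), of w] by simp
  then have "U p = y"
    using LIMSEQ_unique[OF bounded_clinear_tendsto[OF U(1) z(1)]] z(2) by simp
  with \<open>U x = U p\<close> show ?thesis by simp
qed

lemma polar_decomposition_unique:
  assumes "bounded_clinear U" "ker U = ker T" "T = U \<circ> abs_op T"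
    and "bounded_clinear U'" "ker U' = ker T" "T = U' \<circ> abs_op T"
  shows "U = U'"
proof
  fix x
  obtain p y where "polar_rel T x p y"
    using polar_rel_total by blast
  then show "U x = U' x"
    using polar_decomposition_eq[OF assms(1-3)] polar_decomposition_eq[OF assms(4-6)] by simp
qed

lemma polar_factor_characterization:
  shows partial_isometry_polar_factor: "partial_isometry (polar_factor T)"
    and ker_polar_factor: "ker (polar_factor T) = ker T"
    and polar_factor_abs_op: "T = polar_factor T \<circ> abs_op T"
    and polar_factor_unique:
      "partial_isometry U \<Longrightarrow> ker U = ker T \<Longrightarrow> T = U \<circ> abs_op T \<Longrightarrow> polar_factor T = U"
proof -
  have "\<exists>!U. partial_isometry U \<and> ker U = ker T \<and> T = U \<circ> abs_op T"
    using polar_decomposition_exists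
    by (rule ex_ex1I) (metis partial_isometry_def polar_decomposition_unique)
  from theI'[OF this, folded polar_factor_def] the1_equality[OF this, folded polar_factor_def]
  show "partial_isometry (polar_factor T)" "ker (polar_factor T) = ker T"
      "T = polar_factor T \<circ> abs_op T"
    and "partial_isometry U \<Longrightarrow> ker U = ker T \<Longrightarrow> T = U \<circ> abs_op T \<Longrightarrow> polar_factor T = U"
    by blast+
qed

end


section \<open>Tensor products of operators\<close>

lemma norm_tensor: "norm (x \<otimes> y) = norm x * norm y"
proof -
  have "complex_of_real ((norm (x \<otimes> y))\<^sup>2) = complex_of_real ((norm x * norm y)\<^sup>2)"
    unfolding cinner_self[symmetric] cinner_tensor by (simp add: cinner_self power_mult_distrib)
  then have "(norm (x \<otimes> y))\<^sup>2 = (norm x * norm y)\<^sup>2"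
    using of_real_eq_iff by blast
  then show ?thesis
    by (simp add: power2_eq_iff_nonneg)
qed

lemma bounded_clinear_tensor_left: "bounded_clinear (\<lambda>x. x \<otimes> y)"
  by (rule bounded_clinearI[where K = "norm y"])
    (simp_all add: tensor_add_left tensor_scaleC_left norm_tensor)

text \<open>The partial inner product with \<open>y\<close> in the second factor. As an adjoint it
  comes with linearity and boundedness.\<close>

definition slice :: "'b::chilbert_space \<Rightarrow> ('a::chilbert_space \<otimes> 'b) \<Rightarrow> 'a" where
  "slice y = adj (\<lambda>x. x \<otimes> y)"

lemma cinner_slice: "x \<bullet>\<^sub>C slice y u = (x \<otimes> y) \<bullet>\<^sub>C u"
  unfolding slice_def by (rule cinner_adj_right[OF bounded_clinear_tensor_left])

lemma bounded_clinear_slice: "bounded_clinear (slice y)"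
  unfolding slice_def by (rule bounded_clinear_adj[OF bounded_clinear_tensor_left])

lemma slice_tensor: "slice z (x \<otimes> y) = (z \<bullet>\<^sub>C y) *\<^sub>C x"
  by (rule cinner_ext_right) (simp add: cinner_slice cinner_tensor cinner_scaleC_right)

text \<open>Bessel's inequality with vector-valued coefficients: \<open>w\<close> is the component
  of \<open>u\<close> over the basis vectors in \<open>B\<close>, and both
  \<open>w \<bullet>\<^sub>C w\<close> and \<open>w \<bullet>\<^sub>C u\<close> equal the sum in
  question.\<close>

lemma sum_norm_slice_le:
  fixes u :: "'a::chilbert_space \<otimes> 'b::chilbert_space"
  assumes B: "finite B" "B \<subseteq> onb"
  shows "(\<Sum>c\<in>B. (norm (slice c u))\<^sup>2) \<le> (norm u)\<^sup>2"
proof -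
  define s where "s = (\<Sum>c\<in>B. (norm (slice c u))\<^sup>2)"
  define w where "w = (\<Sum>c\<in>B. slice c u \<otimes> c)"
  have w: "w \<bullet>\<^sub>C v = (\<Sum>c\<in>B. slice c u \<bullet>\<^sub>C slice c v)" for v
    by (simp add: w_def cinner_sum_left cinner_slice)
  have slice_w: "slice c w = slice c u" if "c \<in> B" for c
  proof -
    have "slice c w = (\<Sum>d\<in>B. (c \<bullet>\<^sub>C d) *\<^sub>C slice d u)"
      by (simp add: w_def bounded_clinear_sum[OF bounded_clinear_slice] slice_tensor)
    also have "\<dots> = (\<Sum>d\<in>B. if d = c then slice c u else 0)"
      using that B(2) by (intro sum.cong refl) (auto simp: onb_cinner subset_iff)
    finally show ?thesis
      using that B(1) by simp
  qed
  have wu: "w \<bullet>\<^sub>C u = complex_of_real s"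
    unfolding w s_def of_real_sum by (simp add: cinner_self)
  have "w \<bullet>\<^sub>C w = w \<bullet>\<^sub>C u"
    unfolding w by (intro sum.cong refl) (simp add: slice_w)
  then have ws: "(norm w)\<^sup>2 = s"
    unfolding wu cinner_self using of_real_eq_iff by blast
  have "s \<ge> 0"
    unfolding s_def by (simp add: sum_nonneg)
  then have "(norm w)\<^sup>2 \<le> norm w * norm u"
    using cmod_cinner_le[of w u] by (simp add: wu ws)
  then have "norm w \<le> norm u"
    by (cases "w = 0") (simp_all add: power2_eq_square)
  then show ?thesis
    unfolding s_def[symmetric] ws[symmetric] by (intro power_mono) auto
qed

text \<open>Coordinate \<open>(b, c)\<close> of the image is the \<open>b\<close>-coordinate of
  \<open>S\<close> applied to the slice at \<open>c\<close>. Bessel in \<open>b\<close>, the bound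
  of \<open>S\<close> on each slice, and the slice inequality in \<open>c\<close> show that it has
  norm at most \<open>K\<close>.\<close>

lemma tensor_op_left_exists:
  fixes S :: "'a::chilbert_space \<Rightarrow> 'a"
  assumes S: "bounded_clinear S"
  shows "\<exists>A :: 'a \<otimes> 'b::chilbert_space \<Rightarrow> 'a \<otimes> 'b. bounded_clinear A \<and> (\<forall>x y. A (x \<otimes> y) = S x \<otimes> y)"
proof -
  obtain K where K: "K > 0" "\<And>x. norm (S x) \<le> norm x * K"
    by (rule bounded_clinear_bound[OF S]) blast
  define f where "f u = (\<lambda>(b, c). if b \<in> onb \<and> c \<in> onb then b \<bullet>\<^sub>C S (slice c u) else 0)"
    for u :: "'a \<otimes> 'b"
  have bound: "(\<Sum>i\<in>F. (cmod (f u i))\<^sup>2) \<le> (norm u * K)\<^sup>2" if "finite F" for u F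
  proof -
    \<comment> \<open>Enlarging \<open>F\<close> to a rectangle separates the two
      summations.\<close>
    define A B where "A = fst ` F \<inter> onb" and "B = snd ` F \<inter> onb"
    have AB: "finite A" "finite B" "A \<subseteq> onb" "B \<subseteq> onb"
      using \<open>finite F\<close> by (auto simp: A_def B_def)
    have "(\<Sum>i\<in>F. (cmod (f u i))\<^sup>2) = (\<Sum>i\<in>F \<inter> onb \<times> onb. (cmod (f u i))\<^sup>2)"
      using \<open>finite F\<close> by (intro sum.mono_neutral_right) (auto simp: f_def split: if_splits)
    also have "\<dots> \<le> (\<Sum>i\<in>A \<times> B. (cmod (f u i))\<^sup>2)"
      using AB by (intro sum_mono2) (force simp: A_def B_def)+
    also have "\<dots> = (\<Sum>b\<in>A. \<Sum>c\<in>B. (cmod (f u (b, c)))\<^sup>2)"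
      by (simp add: sum.cartesian_product)
    also have "\<dots> = (\<Sum>c\<in>B. \<Sum>b\<in>A. (cmod (b \<bullet>\<^sub>C S (slice c u)))\<^sup>2)"
      using AB by (subst sum.swap) (intro sum.cong refl, auto simp: f_def)
    also have "\<dots> \<le> (\<Sum>c\<in>B. (norm (S (slice c u)))\<^sup>2)"
      using AB by (intro sum_mono bessel_le)
    also have "\<dots> \<le> (\<Sum>c\<in>B. (norm (slice c u))\<^sup>2 * K\<^sup>2)"
      by (intro sum_mono) (simp add: K(2) power_mono flip: power_mult_distrib)
    also have "\<dots> = (\<Sum>c\<in>B. (norm (slice c u))\<^sup>2) * K\<^sup>2"
      by (simp add: sum_distrib_right)
    also have "\<dots> \<le> (norm u)\<^sup>2 * K\<^sup>2"
      using AB by (intro mult_right_mono sum_norm_slice_le) auto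
    finally show ?thesis
      by (simp add: power_mult_distrib)
  qed
  define A where "A u = Abs_htensor (f u)" for u
  have coord_A: "coord (A u) = f u" for u
    unfolding A_def
  proof (rule Abs_htensor_inverse)
    have "square_summable (f u)"
      by (rule square_summableI[OF bound])
    then show "f u \<in> {f. square_summable f \<and> (\<forall>i. i \<notin> onb \<times> onb \<longrightarrow> f i = 0)}"
      by (auto simp: f_def)
  qed
  have "bounded_clinear A"
  proof (rule bounded_clinearI[where K = K])
    show "A (u + v) = A u + A v" for u v
      by (simp add: coord_inject[symmetric] fun_eq_iff plus_htensor.rep_eq coord_A f_def
          bounded_clinear_add[OF bounded_clinear_slice] bounded_clinear_add[OF S] cinner_add_right)
    show "A (c *\<^sub>C u) = c *\<^sub>C A u" for c u
      by (simp add: coord_inject[symmetric] fun_eq_iff scaleC_htensor.rep_eq coord_A f_def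
          bounded_clinear_scaleC[OF bounded_clinear_slice] bounded_clinear_scaleC[OF S] cinner_scaleC_right)
    show "norm (A u) \<le> norm u * K" for u
      by (rule norm_htensor_le) (use bound K(1) in \<open>simp_all add: coord_A\<close>)
  qed
  moreover have "A (x \<otimes> y) = S x \<otimes> y" for x y
    by (simp add: coord_inject[symmetric] fun_eq_iff tensor.rep_eq coord_A f_def slice_tensor
        bounded_clinear_scaleC[OF S] cinner_scaleC_right)
  ultimately show ?thesis by blast
qed

section \<open>The flip of the tensor factors\<close>

lift_definition flip :: "('a::chilbert_space \<otimes> 'b::chilbert_space) \<Rightarrow> 'b \<otimes> 'a"
  is "\<lambda>f (c, b). f (b, c)"
proof -
  fix f :: "'a \<times> 'b \<Rightarrow> complex"
  assume f: "square_summable f \<and> (\<forall>i. i \<notin> onb \<times> onb \<longrightarrow> f i = 0)"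
  have swap: "(\<lambda>(c, b). f (b, c)) = (\<lambda>i. f (prod.swap i))"
    by auto
  have "bij (prod.swap :: 'b \<times> 'a \<Rightarrow> 'a \<times> 'b)"
    by simp
  then have "square_summable (\<lambda>i. f (prod.swap i))"
    using f summable_on_reindex_bij_betw[of prod.swap UNIV UNIV "\<lambda>i. (cmod (f i))\<^sup>2"]
    unfolding square_summable_def by blast
  with f show "square_summable (\<lambda>(c, b). f (b, c)) \<and>
      (\<forall>i. i \<notin> onb \<times> onb \<longrightarrow> (\<lambda>(c, b). f (b, c)) i = 0)"
    unfolding swap by auto
qed

lemma coord_flip: "coord (flip u) i = coord u (prod.swap i)"
  by (cases i) (simp add: flip.rep_eq)

lemma flip_flip [simp]: "flip (flip u) = u"
  by (simp add: coord_inject[symmetric] fun_eq_iff coord_flip)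

text \<open>Swapping coordinates has this basis-free meaning because both tensor products use the
  same chosen basis \<open>onb\<close> of each factor.\<close>

lemma flip_tensor: "flip (x \<otimes> y) = y \<otimes> x"
  by (simp add: coord_inject[symmetric] fun_eq_iff coord_flip tensor.rep_eq mult.commute conj_commute)

lemma cinner_flip:
  fixes u v :: "'a::chilbert_space \<otimes> 'b::chilbert_space"
  shows "flip u \<bullet>\<^sub>C flip v = u \<bullet>\<^sub>C v"
proof -
  have "bij (prod.swap :: 'b \<times> 'a \<Rightarrow> 'a \<times> 'b)"
    by simp
  from infsum_reindex_bij_betw[OF this, of "\<lambda>i. cnj (coord u i) * coord v i"] show ?thesis
    unfolding cinner_htensor_def coord_flip .
qed

lemma norm_flip: "norm (flip u) = norm u"
  using cinner_flip[of u u] by (simp add: norm_eq_sqrt_inner inner_eq_Re_cinner)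

lemma bounded_clinear_flip: "bounded_clinear flip"
  by (rule bounded_clinearI[where K = 1])
    (simp_all add: coord_inject[symmetric] fun_eq_iff coord_flip plus_htensor.rep_eq
      scaleC_htensor.rep_eq norm_flip)

lemma adj_flip: "adj flip = flip"
proof (rule adj_unique[OF bounded_clinear_flip])
  show "flip u \<bullet>\<^sub>C v = u \<bullet>\<^sub>C flip v" for u v
    using cinner_flip[of u "flip v"] by simp
qed

lemma unitary_op_flip: "unitary_op flip"
  unfolding unitary_op_def adj_flip by (auto simp: bounded_clinear_flip)

text \<open>The zero set of the difference is a closed subspace containing the simple tensors, whose
  span is dense.\<close>

lemma bounded_clinear_eq_on_tensors:
  fixes A B :: "'a::chilbert_space \<otimes> 'b::chilbert_space \<Rightarrow> 'c::complex_inner"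
  assumes A: "bounded_clinear A" and B: "bounded_clinear B"
    and eq: "\<And>x y. A (x \<otimes> y) = B (x \<otimes> y)"
  shows "A = B"
proof -
  let ?D = "\<lambda>u. A u - B u"
  have D: "bounded_linear ?D"
    using bounded_clinear_diff_op[OF A B] by (simp add: bounded_clinear_def)
  have "span (range (\<lambda>(x :: 'a, y :: 'b). x \<otimes> y)) \<subseteq> {u. ?D u = 0}"
    using eq by (intro span_minimal linear_subspace_kernel bounded_linear.linear[OF D]) auto
  moreover have "closed {u. ?D u = 0}"
    by (intro closed_Collect_eq continuous_on_const linear_continuous_on D)
  ultimately have "closure (span (range (\<lambda>(x :: 'a, y :: 'b). x \<otimes> y))) \<subseteq> {u. ?D u = 0}"
    by (rule closure_minimal)
  then show ?thesis
    unfolding tensor_total by auto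
qed

lemma tensor_op_unique:
  assumes "bounded_clinear A" "\<And>x y. A (x \<otimes> y) = S x \<otimes> T y"
  shows "S \<otimes>\<^sub>o T = A"
  unfolding tensor_op_def
proof (rule the_equality)
  fix B assume "bounded_clinear B \<and> (\<forall>x y. B (x \<otimes> y) = S x \<otimes> T y)"
  then show "B = A"
    using assms by (intro bounded_clinear_eq_on_tensors) simp_all
qed (simp add: assms)

lemma tensor_op_characterization:
  assumes "bounded_clinear S" "bounded_clinear T"
  shows bounded_clinear_tensor_op: "bounded_clinear (S \<otimes>\<^sub>o T)"
    and tensor_op_tensor: "(S \<otimes>\<^sub>o T) (x \<otimes> y) = S x \<otimes> T y"
proof -
  obtain A :: "'a \<otimes> 'b \<Rightarrow> 'a \<otimes> 'b" where A: "bounded_clinear A" "\<And>x y. A (x \<otimes> y) = S x \<otimes> y"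
    using tensor_op_left_exists[OF assms(1)] by blast
  obtain B :: "'b \<otimes> 'a \<Rightarrow> 'b \<otimes> 'a" where B: "bounded_clinear B" "\<And>y x. B (y \<otimes> x) = T y \<otimes> x"
    using tensor_op_left_exists[OF assms(2)] by blast
  \<comment> \<open>\<open>A\<close> is \<open>S \<otimes> 1\<close>, and conjugating
    \<open>B\<close> by the flip turns \<open>T \<otimes> 1\<close> into
    \<open>1 \<otimes> T\<close>.\<close>
  have "bounded_clinear (A \<circ> (flip \<circ> (B \<circ> flip)))"
    by (intro bounded_clinear_compose A B bounded_clinear_flip)
  moreover have AB: "(A \<circ> (flip \<circ> (B \<circ> flip))) (x \<otimes> y) = S x \<otimes> T y" for x y
    by (simp add: A B flip_tensor)
  ultimately have "S \<otimes>\<^sub>o T = A \<circ> (flip \<circ> (B \<circ> flip))"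
    by (rule tensor_op_unique)
  with AB \<open>bounded_clinear (A \<circ> (flip \<circ> (B \<circ> flip)))\<close>
  show "bounded_clinear (S \<otimes>\<^sub>o T)" "(S \<otimes>\<^sub>o T) (x \<otimes> y) = S x \<otimes> T y"
    by (simp_all only:)
qed

text \<open>\<open>adj flip\<close> is kept in place of \<open>flip\<close> so that the right-hand
  side has the shape \<open>V \<circ> A \<circ> adj V\<close> of the transport lemmas.\<close>

lemma tensor_op_flip:
  assumes "bounded_clinear S" "bounded_clinear T"
  shows "T \<otimes>\<^sub>o S = flip \<circ> (S \<otimes>\<^sub>o T) \<circ> adj flip"
  unfolding adj_flip
  by (rule tensor_op_unique)
    (simp_all add: bounded_clinear_compose bounded_clinear_flip assms flip_tensor
      bounded_clinear_tensor_op tensor_op_tensor)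


section \<open>Transport along a unitary operator\<close>

context
  fixes V :: "'a::chilbert_space \<Rightarrow> 'b::chilbert_space"
  assumes V: "unitary_op V"
begin

lemma unitary_op_props:
  shows unitary_bounded_clinear: "bounded_clinear V"
    and unitary_adj_bounded_clinear: "bounded_clinear (adj V)"
    and unitary_adj_apply: "adj V (V x) = x"
    and unitary_apply_adj: "V (adj V y) = y"
  using V by (auto simp: unitary_op_def bounded_clinear_adj fun_eq_iff)

lemma norm_unitary: "norm (V x) = norm x"
proof -
  have "V x \<bullet>\<^sub>C V x = x \<bullet>\<^sub>C x"
    using cinner_adj_right[OF unitary_bounded_clinear, of x "V x"] by (simp add: unitary_adj_apply)
  then show ?thesis
    by (simp add: norm_eq_sqrt_inner inner_eq_Re_cinner)
qed

lemma norm_unitary_adj: "norm (adj V y) = norm y"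
  using norm_unitary[of "adj V y"] by (simp add: unitary_apply_adj)

lemma bounded_clinear_conj: "bounded_clinear A \<Longrightarrow> bounded_clinear (V \<circ> A \<circ> adj V)"
  by (intro bounded_clinear_compose unitary_bounded_clinear unitary_adj_bounded_clinear)

lemma cinner_conj: "y \<bullet>\<^sub>C V x = adj V y \<bullet>\<^sub>C x"
  by (rule cinner_adj_left[OF unitary_bounded_clinear, symmetric])

lemma adj_conj: "bounded_clinear A \<Longrightarrow> adj (V \<circ> A \<circ> adj V) = V \<circ> adj A \<circ> adj V"
  by (rule adj_unique)
    (simp_all add: bounded_clinear_conj bounded_clinear_adj cinner_conj cinner_adj_right
      flip: cinner_adj_right[OF unitary_bounded_clinear])

text \<open>By uniqueness of the positive root: inner factors \<open>adj V \<circ> V\<close> cancel,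
  so the conjugated root squares to the conjugate of \<open>adj A \<circ> A\<close>.\<close>

lemma abs_op_conj:
  assumes A: "bounded_clinear A"
  shows "abs_op (V \<circ> A \<circ> adj V) = V \<circ> abs_op A \<circ> adj V"
proof (rule abs_op_unique[OF bounded_clinear_conj[OF A]])
  show "positive_op (V \<circ> abs_op A \<circ> adj V)"
    using positive_op_abs_op[OF A]
    by (auto simp: positive_op_def cinner_conj intro: bounded_clinear_conj)
  show "(V \<circ> abs_op A \<circ> adj V) \<circ> (V \<circ> abs_op A \<circ> adj V) = adj (V \<circ> A \<circ> adj V) \<circ> (V \<circ> A \<circ> adj V)"
    using abs_op_square[OF A] by (simp add: adj_conj[OF A] fun_eq_iff unitary_adj_apply)
qed

lemma unitary_eq_0_iff: "V x = 0 \<longleftrightarrow> x = 0"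
  using norm_unitary[of x] by (metis norm_eq_zero)

lemma partial_isometry_conj:
  assumes U: "partial_isometry U"
  shows "partial_isometry (V \<circ> U \<circ> adj V)"
  unfolding partial_isometry_def
proof (intro conjI ballI)
  fix y assume y: "y \<in> orth_compl (ker (V \<circ> U \<circ> adj V))"
  \<comment> \<open>\<open>V\<close> carries \<open>ker U\<close> into the kernel of the conjugate,
    so \<open>adj V\<close> carries the orthogonal complement back.\<close>
  have "adj V y \<bullet>\<^sub>C x = 0" if "U x = 0" for x
  proof -
    have "V x \<in> ker (V \<circ> U \<circ> adj V)"
      by (simp add: ker_def unitary_adj_apply that unitary_eq_0_iff)
    then show ?thesis
      using y by (simp add: orth_compl_def flip: cinner_conj)
  qed
  then have "adj V y \<in> orth_compl (ker U)"
    by (simp add: orth_compl_def ker_def)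
  then show "norm ((V \<circ> U \<circ> adj V) y) = norm y"
    using U by (simp add: partial_isometry_def norm_unitary norm_unitary_adj)
qed (use U in \<open>simp add: partial_isometry_def bounded_clinear_conj\<close>)

lemma polar_factor_conj:
  assumes A: "bounded_clinear A"
  shows "polar_factor (V \<circ> A \<circ> adj V) = V \<circ> polar_factor A \<circ> adj V"
proof (rule polar_factor_unique[OF bounded_clinear_conj[OF A]])
  show "partial_isometry (V \<circ> polar_factor A \<circ> adj V)"
    by (intro partial_isometry_conj partial_isometry_polar_factor A)
  show "ker (V \<circ> polar_factor A \<circ> adj V) = ker (V \<circ> A \<circ> adj V)"
    using ker_polar_factor[OF A] by (auto simp: ker_def unitary_eq_0_iff)
  show "V \<circ> A \<circ> adj V = V \<circ> polar_factor A \<circ> adj V \<circ> abs_op (V \<circ> A \<circ> adj V)"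
    using fun_cong[OF polar_factor_abs_op[OF A]]
    by (simp add: abs_op_conj[OF A] fun_eq_iff unitary_adj_apply)
qed

lemma mean_transform_conj:
  assumes A: "bounded_clinear A"
  shows "mean_transform l (V \<circ> A \<circ> adj V) = V \<circ> mean_transform l A \<circ> adj V"
  by (simp add: mean_transform_def duggal_def abs_op_conj[OF A] polar_factor_conj[OF A] fun_eq_iff
      unitary_adj_apply bounded_clinear_add[OF unitary_bounded_clinear]
      bounded_clinear_scaleR[OF unitary_bounded_clinear])

lemma isometry_op_unitary: "isometry_op V" "isometry_op (adj V)"
  by (simp_all add: isometry_op_def unitary_bounded_clinear unitary_adj_bounded_clinear
      norm_unitary norm_unitary_adj)

lemma unitary_conj_cancel: "adj V \<circ> (V \<circ> A \<circ> adj V) \<circ> V = A"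
  by (simp add: fun_eq_iff unitary_adj_apply)

end

theorem proposition9:
  fixes S :: "'a::chilbert_space \<Rightarrow> 'a" and T :: "'b::chilbert_space \<Rightarrow> 'b" and l :: real
  assumes "bounded_clinear S" and "bounded_clinear T" and "0 \<le> l" and "l \<le> 1"
  shows "dilates (mean_transform l (T \<otimes>\<^sub>o S)) (mean_transform l (S \<otimes>\<^sub>o T)) \<and>
    dilates (mean_transform l (S \<otimes>\<^sub>o T)) (mean_transform l (T \<otimes>\<^sub>o S)) \<and>
    (\<exists>V :: 'a \<otimes> 'b \<Rightarrow> 'b \<otimes> 'a. unitary_op V \<and>
      mean_transform l (T \<otimes>\<^sub>o S) = V \<circ> mean_transform l (S \<otimes>\<^sub>o T) \<circ> adj V \<and>
      mean_transform l (S \<otimes>\<^sub>o T) = adj V \<circ> mean_transform l (T \<otimes>\<^sub>o S) \<circ> V)"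
proof -
  let ?V = "flip :: 'a \<otimes> 'b \<Rightarrow> 'b \<otimes> 'a"
  note V = unitary_op_flip[where 'a = 'a and 'b = 'b]
  have TS: "mean_transform l (T \<otimes>\<^sub>o S) = ?V \<circ> mean_transform l (S \<otimes>\<^sub>o T) \<circ> adj ?V"
    unfolding tensor_op_flip[OF assms(1,2)]
    by (rule mean_transform_conj[OF V bounded_clinear_tensor_op[OF assms(1,2)]])
  have ST: "mean_transform l (S \<otimes>\<^sub>o T) = adj ?V \<circ> mean_transform l (T \<otimes>\<^sub>o S) \<circ> ?V"
    unfolding TS by (rule unitary_conj_cancel[OF V, symmetric])
  \<comment> \<open>The dilating isometries are \<open>?V\<close> in one direction and
    \<open>adj ?V\<close> in the other; the second choice needs the adjoint of
    \<open>adj ?V\<close>.\<close>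
  have "adj (adj ?V) = ?V"
    by (rule adj_adj[OF bounded_clinear_flip])
  then show ?thesis
    unfolding dilates_def using V TS ST isometry_op_unitary[OF V] by metis
qed

end
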